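(* Let $P$ be the Bergman projection regarded as an operator $P: L^{1}(D,d\lambda)\to B_{1}$, and let $P^{\ast}:\mathcal{B}\to L^{\infty}(D)$ be its adjoint, where $(B_1)^{\ast}$ is identified with the Bloch space $\mathcal{B}$ through the invariant pairing $\langle h,g\rangle=\int_{D}h'(z)\overline{g'(z)}\,dA(z)$ and $(L^{1}(D,d\lambda))^{\ast}$ is identified with $L^{\infty}(D)$ through the pairing $\int_D f\,\overline{u}\,d\lambda$. Then $P^{\ast}$ is a bounded operator and $$2\le \|P^{\ast}\|\le 4 .$$
   Context: $D$ is the open unit disc in $\mathbb{C}$, $dA(z)=\frac1\pi\,dx\,dy$ is normalized area measure, and $d\lambda(z)=(1-|z|^2)^{-2}dA(z)$ is the Möbius invariant measure. The Bergman projection is $Pf(z)=\int_{D}\frac{f(w)}{(1-z\bar w)^{2}}\,dA(w)$, $z\in D$. The Besov space $B_1$ is the space of analytic functions $f$ on $D$ that can be written as $f(z)=\sum_{n=1}^{\infty}a_n\varphi_{\lambda_n}(z)$ for some $(a_n)\in\ell^1$ and some sequence $(\lambda_n)$ in $D$, where $\varphi_{\lambda}(z)=\frac{z-\lambda}{1-z\bar\lambda}$. Its norm $\|f\|_{B_1}$ is the infimum of $\sum_{n}|a_n|$ over all such representations. $P$ maps $L^1(D,d\lambda)$ into (in fact onto) $B_1$. The Bloch space $\mathcal{B}$ is the space of analytic functions $g$ on $D$ with $\|g\|_{\mathcal{B}}:=\sup_{z\in D}(1-|z|^2)|g'(z)|<\infty$ (a semi-norm vanishing exactly on constants). The adjoint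 $P^{\ast}$ is the following operator: for $g\in\mathcal{B}$, $P^{\ast}g$ is the element of $L^{\infty}(D)$ determined by $$\int_{D}f(z)\overline{P^{\ast}g(z)}\,d\lambda(z)=\int_{D}(Pf)'(z)\overline{g'(z)}\,dA(z)\qquad\text{for all } f\in L^{1}(D,d\lambda),$$ where the integral on the right is understood as $\lim_{r\to1^-}\int_{|z|<r}(Pf)'(z)\overline{g'(z)}\,dA(z)$. The norm $\|P^{\ast}\|$ is the least constant $C$ with $\|P^{\ast}g\|_{L^\infty(D)}\le C\|g\|_{\mathcal{B}}$ for all $g\in\mathcal{B}$. *)

theory Defs
  imports "HOL-Probability.Essential_Supremum" "HOL-Analysis.Analysis"
begin

abbreviation unit_disc :: "complex set" where
  "unit_disc \<equiv> ball 0 1"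

definition area :: "complex measure" where
  "area = density (restrict_space lborel unit_disc) (\<lambda>_. ennreal (1 / pi))"

definition moebius_measure :: "complex measure" where
  "moebius_measure = density area (\<lambda>z. ennreal (1 / (1 - (cmod z)\<^sup>2)\<^sup>2))"

text \<open>
  Elements of the Lebesgue spaces are represented by functions; equality of elements is
  equality almost everywhere. The measures \<^const>\<open>area\<close> and \<^const>\<open>moebius_measure\<close> have the
  same null sets, so either may be used for the essential supremum.
\<close>

definition L1_moebius :: "(complex \<Rightarrow> complex) set" where
  "L1_moebius = {f. integrable moebius_measure f}"

definition Linf_norm :: "(complex \<Rightarrow> complex) \<Rightarrow> ereal" where
  "Linf_norm u = esssup area (\<lambda>z. ereal (cmod (u z)))"

definition Linf :: "(complex \<Rightarrow> complex) set" where
  "Linf = {u \<in> borel_measurable area. Linf_norm u < \<infinity>}"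

definition bergman_projection :: "(complex \<Rightarrow> complex) \<Rightarrow> complex \<Rightarrow> complex" where
  "bergman_projection f z = (LINT w|area. f w / (1 - z * cnj w)\<^sup>2)"

definition bloch :: "(complex \<Rightarrow> complex) set" where
  "bloch = {g. g holomorphic_on unit_disc \<and>
               bdd_above ((\<lambda>z. (1 - (cmod z)\<^sup>2) * cmod (deriv g z)) ` unit_disc)}"

definition bloch_seminorm :: "(complex \<Rightarrow> complex) \<Rightarrow> real" where
  "bloch_seminorm g = (SUP z\<in>unit_disc. (1 - (cmod z)\<^sup>2) * cmod (deriv g z))"

text \<open>
  \<open>has_invariant_pairing h g c\<close>: the pairing of \<open>h\<close> and \<open>g\<close> exists and equals \<open>c\<close>. It is a
  limit over discs of radius \<open>r < 1\<close>, since the integrand need not be integrable over the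
  whole unit disc.
\<close>

definition has_invariant_pairing ::
    "(complex \<Rightarrow> complex) \<Rightarrow> (complex \<Rightarrow> complex) \<Rightarrow> complex \<Rightarrow> bool" where
  "has_invariant_pairing h g c \<longleftrightarrow>
     ((\<lambda>r::real. LINT z:ball 0 r|area. deriv h z * cnj (deriv g z)) \<longlongrightarrow> c) (at_left 1)"

definition is_adjoint_value ::
    "(complex \<Rightarrow> complex) \<Rightarrow> (complex \<Rightarrow> complex) \<Rightarrow> bool" where
  "is_adjoint_value g u \<longleftrightarrow>
     u \<in> Linf \<and>
     (\<forall>f\<in>L1_moebius. has_invariant_pairing (bergman_projection f) g
                        (LINT z|moebius_measure. f z * cnj (u z)))"

text \<open>A representative of the adjoint applied to \<open>g\<close>.\<close>

definition bergman_adjoint :: "(complex \<Rightarrow> complex) \<Rightarrow> complex \<Rightarrow> complex" where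
  "bergman_adjoint g = (SOME u. is_adjoint_value g u)"

text \<open>
  Operator norm from the Bloch space to \<open>L\<^sup>\<infinity>\<close>: the least admissible constant, with value
  \<open>\<infinity>\<close> if there is none.
\<close>

definition bloch_Linf_opnorm ::
    "((complex \<Rightarrow> complex) \<Rightarrow> complex \<Rightarrow> complex) \<Rightarrow> ereal" where
  "bloch_Linf_opnorm T =
     Inf (ereal ` {C. 0 \<le> C \<and> (\<forall>g\<in>bloch. Linf_norm (T g) \<le> ereal (C * bloch_seminorm g))})"

end

theory Submission
  imports Defs "HOL-Complex_Analysis.Riemann_Mapping" "HOL-Probability.Distribution_Functions"
begin

text \<open>
  The adjoint is explicit: \<open>P\<^sup>* g (w) = (1 - |w|\<^sup>2)\<^sup>2 G'(w)\<close> almost everywhere, where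
  \<open>G(z) = z\<^sup>2 g'(z)\<close>. All parts of the theorem are read off from this formula.

  To find the formula, expand \<open>Pf(z) = \<Sum>\<^sub>n (n + 1) c\<^sub>n z\<^sup>n\<close> with
  \<open>c\<^sub>n = \<integral> f(w) cnj(w)\<^sup>n dA(w)\<close>, and \<open>g'(z) = \<Sum>\<^sub>n b\<^sub>n z\<^sup>n\<close>. Distinct monomials are
  orthogonal on the disc of radius \<open>r\<close>, and the square norm of \<open>z\<^sup>n\<close> there is
  \<open>r\<^bsup>2n+2\<^esup> / (n + 1)\<close>. So the truncated pairing of \<open>Pf\<close> with \<open>g\<close> is
  \<open>\<Sum>\<^sub>n (n + 2) c\<^bsub>n+1\<^esub> cnj(b\<^sub>n) r\<^bsup>2n+2\<^esup>\<close>. Since \<open>G'(w) = \<Sum>\<^sub>n (n + 2) b\<^sub>n w\<^bsup>n+1\<^esup>\<close>, this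
  number is \<open>\<integral> f(w) cnj(G'(r\<^sup>2 w)) dA(w)\<close>; this is \<open>bergman_pairing_on_disc\<close>.

  The upper bound is \<open>weighted_deriv_square_times_deriv_le\<close>:
  \<open>(1 - |w|\<^sup>2)\<^sup>2 |G'(w)| \<le> 4 \<parallel>g\<parallel>\<close>. On the disc of radius \<open>R < 1\<close> the function \<open>G\<close> is bounded by
  \<open>\<parallel>g\<parallel> / (1 - R\<^sup>2)\<close>, so the Schwarz-Pick inequality on that disc gives
  \<open>|G'(w)| \<le> R \<parallel>g\<parallel> / ((1 - R\<^sup>2) (R\<^sup>2 - |w|\<^sup>2))\<close>. Taking \<open>R\<^sup>2\<close> halfway between \<open>|w|\<^sup>2\<close> and \<open>1\<close>
  makes both factors of the denominator \<open>(1 - |w|\<^sup>2) / 2\<close>, which produces the constant \<open>4\<close>. The same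
  bound is the domination needed to let \<open>r\<close> tend to \<open>1\<close> in the truncated pairing, for every
  \<open>f\<close> in \<open>L\<^sup>1(d\<lambda>)\<close>; so it also proves that the formula gives the adjoint.

  The value of the adjoint is unique almost everywhere because the difference \<open>d\<close> of two candidates can
  be tested against \<open>f(z) = (1 - |z|\<^sup>2)\<^sup>2 d(z)\<close>, which gives \<open>\<integral> |d|\<^sup>2 dA = 0\<close>. Linearity follows
  from the formula.

  For the lower bound let \<open>g(z) = log((1 + z) / (1 - z)) / 2\<close>, so that \<open>g'(z) = 1 / (1 - z\<^sup>2)\<close> and
  \<open>\<parallel>g\<parallel> \<le> 1\<close>. At a real point \<open>x\<close> the formula gives \<open>P\<^sup>* g (x) = 2x\<close>, which tends to \<open>2\<close> at
  the boundary point \<open>1\<close>, and \<open>P\<^sup>* g\<close> is continuous, so its essential supremum is at least \<open>2\<close>.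
\<close>

unbundle no fps_syntax

section \<open>Rotation invariance of Lebesgue measure on the plane\<close>

text \<open>
  Multiplication by a unimodular number is an orthogonal map of \<^typ>\<open>real^2\<close>, so the invariance of
  Lebesgue measure under such maps carries over to the plane along this identification.
\<close>

lemma lborel_complex_eq_distr:
  "(lborel :: complex measure) = distr (lborel :: (real^2) measure) borel (\<lambda>v. Complex (v$1) (v$2))"
proof (rule lborel_eqI)
  have cont: "continuous_on UNIV (\<lambda>v::real^2. Complex (v$1) (v$2))"
    unfolding Complex_eq by (intro continuous_intros)
  have [measurable]: "(\<lambda>v::real^2. Complex (v$1) (v$2)) \<in> borel_measurable borel"
    by (rule borel_measurable_continuous_onI[OF cont])
  fix l u :: complex assume "\<And>b. b \<in> Basis \<Longrightarrow> l \<bullet> b \<le> u \<bullet> b"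
  from this[of 1] this[of \<i>] have le: "Re l \<le> Re u" "Im l \<le> Im u"
    by (simp_all add: Basis_complex_def)
  let ?l = "vector [Re l, Im l] :: real^2" and ?u = "vector [Re u, Im u] :: real^2"
  have pre: "(\<lambda>v::real^2. Complex (v$1) (v$2)) -` box l u = box ?l ?u"
    by (auto simp: in_box_complex_iff mem_box_cart forall_2 )
  have "emeasure lborel (box ?l ?u) = emeasure lborel (cbox ?l ?u)"
    by (simp add: emeasure_lborel_box_eq emeasure_lborel_cbox_eq)
  also have "\<dots> = ennreal (measure lborel (cbox ?l ?u))"
    using emeasure_lborel_cbox_finite[of ?l ?u] by (intro emeasure_eq_ennreal_measure) auto
  also have "measure lborel (cbox ?l ?u) = (Re u - Re l) * (Im u - Im l)"
  proof -
    have "?l \<in> cbox ?l ?u"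
      using le by (simp add: mem_box_cart forall_2)
    then show ?thesis
      by (subst content_cbox_cart) (auto simp: UNIV_2)
  qed
  also have "\<dots> = (\<Prod>b\<in>Basis. (u - l) \<bullet> b)"
    by (simp add: Basis_complex_def)
  finally show "emeasure (distr lborel borel (\<lambda>v::real^2. Complex (v$1) (v$2))) (box l u) =
      (\<Prod>b\<in>Basis. (u - l) \<bullet> b)"
    by (subst emeasure_distr) (simp_all add: pre)
qed simp

lemma distr_lborel_orthogonal:
  fixes f :: "real^'n::{finite,wellorder} \<Rightarrow> real^'n::_"
  assumes f: "orthogonal_transformation f"
  shows "distr lborel borel f = lborel"
proof (rule sym, rule lborel_eqI)
  have bij: "bij f" and inv: "orthogonal_transformation (inv f)"
    using f orthogonal_transformation_bij orthogonal_transformation_inv by auto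
  have [measurable]: "f \<in> borel_measurable borel"
    using f by (intro borel_measurable_continuous_onI linear_continuous_on)
      (simp add: linear_linear orthogonal_transformation_linear)
  fix l u :: "real^'n::{finite,wellorder}" assume le: "\<And>b. b \<in> Basis \<Longrightarrow> l \<bullet> b \<le> u \<bullet> b"
  have pre: "f -` box l u = inv f ` box l u"
    using bij by (simp add: bij_vimage_eq_inv_image)
  have S: "f -` box l u \<in> sets borel" 
    using measurable_sets_borel[of f borel "box l u"] by simp
  have "emeasure lborel (f -` box l u) = emeasure lebesgue (inv f ` box l u)"
    using S by (simp add: pre)
  also have "\<dots> = ennreal (measure lebesgue (inv f ` box l u))"
    using measurable_orthogonal_image[OF inv, of "box l u"] by (intro emeasure_eq_measure2) auto
  also have "\<dots> = ennreal (measure lebesgue (box l u))"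
    using measure_orthogonal_image[OF inv, of "box l u"] by simp
  also have "\<dots> = (\<Prod>b\<in>Basis. (u - l) \<bullet> b)"
    using le by (simp add: measure_lborel_box_eq)
  finally show "emeasure (distr lborel borel f) (box l u) = (\<Prod>b\<in>Basis. (u - l) \<bullet> b)"
    by (simp add: emeasure_distr)
qed simp

lemma distr_lborel_rotation:
  fixes c :: complex
  assumes "cmod c = 1"
  shows "distr lborel borel (\<lambda>z. c * z) = lborel"
proof -
  define C where "C = (\<lambda>v::real^2. Complex (v$1) (v$2))"
  define R where "R = (\<lambda>v::real^2. vector [Re c * v$1 - Im c * v$2, Im c * v$1 + Re c * v$2] :: real^2)"
  have C [measurable]: "C \<in> borel_measurable borel"
    unfolding C_def Complex_eq by (intro borel_measurable_continuous_onI continuous_intros)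
  have c: "(Re c)\<^sup>2 + (Im c)\<^sup>2 = 1"
    using assms by (simp add: cmod_power2[symmetric])
  have "linear R"
    by (rule linearI) (simp_all add: R_def vec_eq_iff forall_2 algebra_simps)
  moreover have "R v \<bullet> R w = ((Re c)\<^sup>2 + (Im c)\<^sup>2) * (v \<bullet> w)" for v w
    by (simp add: R_def inner_vec_def sum_2 power2_eq_square algebra_simps)
  ultimately have R: "orthogonal_transformation R"
    using c by (simp add: orthogonal_transformation_def)
  then have [measurable]: "R \<in> borel_measurable borel"
    by (intro borel_measurable_continuous_onI linear_continuous_on)
      (simp add: linear_linear orthogonal_transformation_linear)
  have CR: "c * C v = C (R v)" for v
    by (simp add: C_def R_def complex_eq_iff)
  have "distr lborel borel (\<lambda>z. c * z) = distr (distr lborel borel C) borel (\<lambda>z. c * z)"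
    unfolding C_def by (simp flip: lborel_complex_eq_distr)
  also have "\<dots> = distr (distr lborel borel R) borel C"
    by (simp add: distr_distr o_def CR)
  also have "\<dots> = lborel"
    unfolding distr_lborel_orthogonal[OF R] unfolding C_def by (simp flip: lborel_complex_eq_distr)
  finally show ?thesis .
qed

section \<open>Normalized area measure\<close>

lemma space_area [simp]: "space area = unit_disc"
  by (simp add: area_def space_restrict_space)

lemma sets_area: "sets area = sets (restrict_space borel unit_disc)"
  by (simp add: area_def cong: sets_restrict_space_cong)

lemma measurable_area_iff:
  "f \<in> borel_measurable area \<longleftrightarrow> f \<in> borel_measurable (restrict_space borel unit_disc)"
  by (intro arg_cong[where f="\<lambda>S. f \<in> S"] measurable_cong_sets sets_area refl)

lemma borel_measurable_areaI [measurable (raw)]: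
  "f \<in> borel_measurable borel \<Longrightarrow> f \<in> borel_measurable area"
  unfolding measurable_area_iff by (rule measurable_restrict_space1)

lemma borel_measurable_area_continuous_on:
  "continuous_on unit_disc f \<Longrightarrow> f \<in> borel_measurable area"
  unfolding measurable_area_iff by (rule borel_measurable_continuous_on_restrict)

lemma AE_areaI: "(\<And>z. cmod z < 1 \<Longrightarrow> P z) \<Longrightarrow> AE z in area. P z"
  by (rule AE_I2) simp

lemma emeasure_area:
  assumes "A \<in> sets borel" "A \<subseteq> unit_disc"
  shows "emeasure area A = ennreal (1 / pi) * emeasure lborel A"
proof -
  have A: "A \<in> sets (restrict_space lborel unit_disc)"
    using assms by (auto simp: sets_restrict_space_iff)
  have "emeasure area A = ennreal (1 / pi) * emeasure (restrict_space lborel unit_disc) A"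
    unfolding area_def using A by (subst emeasure_density_const) auto
  also have "emeasure (restrict_space lborel unit_disc) A = emeasure lborel A"
    using assms by (subst emeasure_restrict_space) auto
  finally show ?thesis .
qed

lemma emeasure_area_cball:
  assumes "0 \<le> r" "r < 1"
  shows "emeasure area (cball 0 r) = ennreal (r\<^sup>2)"
proof -
  have "emeasure area (cball 0 r) = ennreal (1 / pi) * ennreal (pi * r\<^sup>2)"
    using assms by (subst emeasure_area) (auto simp: emeasure_cball unit_ball_vol_2)
  also have "\<dots> = ennreal (r\<^sup>2)"
    by (simp flip: ennreal_mult)
  finally show ?thesis .
qed

lemma emeasure_area_disc: "emeasure area unit_disc = 1"
proof -
  have "emeasure area unit_disc = ennreal (1 / pi) * ennreal pi"
    by (subst emeasure_area) (auto simp: emeasure_ball unit_ball_vol_2)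
  also have "\<dots> = 1"
    by (simp flip: ennreal_mult)
  finally show ?thesis .
qed

lemma prob_space_area: "prob_space area"
  by (rule prob_spaceI) (simp add: emeasure_area_disc)

interpretation area: prob_space area by (rule prob_space_area)

lemma integral_area_lborel:
  fixes h :: "complex \<Rightarrow> complex"
  assumes [measurable]: "h \<in> borel_measurable borel"
  shows "integral\<^sup>L area h = (1 / pi) *\<^sub>R (\<integral>z. indicator unit_disc z *\<^sub>R h z \<partial>lborel)"
proof -
  have [measurable]: "h \<in> borel_measurable (restrict_space lborel unit_disc)"
    by (rule measurable_restrict_space1) simp
  have "integral\<^sup>L area h = (\<integral>z. (1 / pi) *\<^sub>R h z \<partial>restrict_space lborel unit_disc)"
    unfolding area_def by (subst integral_density) auto
  also have "\<dots> = (1 / pi) *\<^sub>R (\<integral>z. indicator unit_disc z *\<^sub>R h z \<partial>lborel)"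
    by (simp add: integral_restrict_space)
  finally show ?thesis .
qed

lemma integral_area_rotation:
  fixes h :: "complex \<Rightarrow> complex"
  assumes h [measurable]: "h \<in> borel_measurable borel" and c: "cmod c = 1"
  shows "(\<integral>z. h (c * z) \<partial>area) = integral\<^sup>L area h"
proof -
  have k [measurable]: "(\<lambda>z. indicator unit_disc z *\<^sub>R h z) \<in> borel_measurable borel"
    by (intro borel_measurable_scaleR borel_measurable_indicator h) auto
  have "(\<integral>z. indicator unit_disc z *\<^sub>R h z \<partial>lborel) =
      (\<integral>z. indicator unit_disc z *\<^sub>R h z \<partial>distr lborel borel (\<lambda>z. c * z))"
    by (simp add: distr_lborel_rotation[OF c])
  also have "\<dots> = (\<integral>z. indicator unit_disc (c * z) *\<^sub>R h (c * z) \<partial>lborel)"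
    by (rule integral_distr) (use k in simp_all)
  also have "\<dots> = (\<integral>z. indicator unit_disc z *\<^sub>R h (c * z) \<partial>lborel)"
    by (intro Bochner_Integration.integral_cong) (auto simp: indicator_def norm_mult c)
  finally show ?thesis
    by (subst (1 2) integral_area_lborel) auto
qed

text \<open>
  A centred disc of radius \<open>r < 1\<close> has normalized area \<open>r\<^sup>2\<close>, so \<open>|z|\<^sup>2\<close> has the distribution function
  of the uniform distribution. This replaces polar coordinates for radial integrands.
\<close>

lemma distr_area_norm_square:
  "distr area borel (\<lambda>z. (cmod z)\<^sup>2) = uniform_measure lborel {0..1::real}"
proof (rule cdf_unique)
  show "real_distribution (distr area borel (\<lambda>z. (cmod z)\<^sup>2))"
    by (intro area.real_distribution_distr) measurable
  have "prob_space (uniform_measure lborel {0..1::real})"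
    by (rule prob_space_uniform_measure) auto
  then show "real_distribution (uniform_measure lborel {0..1::real})"
    by (simp add: real_distribution_def real_distribution_axioms_def)
  show "cdf (distr area borel (\<lambda>z. (cmod z)\<^sup>2)) = cdf (uniform_measure lborel {0..1})"
  proof
    fix t :: real
    have L: "cdf (distr area borel (\<lambda>z. (cmod z)\<^sup>2)) t =
        measure area ({z. (cmod z)\<^sup>2 \<le> t} \<inter> unit_disc)"
      unfolding cdf_def by (subst measure_distr) (auto simp: vimage_def)
    have R: "cdf (uniform_measure lborel {0..1}) t = measure lborel ({0..1} \<inter> {..t})"
      unfolding cdf_def by (subst measure_uniform_measure) auto
    consider "t < 0" | "0 \<le> t" "t < 1" | "1 \<le> t" by linarith
    then show "cdf (distr area borel (\<lambda>z. (cmod z)\<^sup>2)) t = cdf (uniform_measure lborel {0..1}) t"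
    proof cases
      case 1
      then have "{z. (cmod z)\<^sup>2 \<le> t} = {}" "{0..1} \<inter> {..t} = {}"
        by (auto simp: not_le intro: less_le_trans)
      then show ?thesis by (simp add: L R)
    next
      case 2
      have "{z. (cmod z)\<^sup>2 \<le> t} \<inter> unit_disc = cball 0 (sqrt t)"
      proof (intro set_eqI iffI)
        fix z assume "z \<in> cball (0::complex) (sqrt t)"
        then have z: "cmod z \<le> sqrt t" by simp
        moreover have "cmod z < 1" using le_less_trans[OF z, of 1] 2 by simp
        moreover have "(cmod z)\<^sup>2 \<le> t"
          using power_mono[OF z, of 2] 2 by simp
        ultimately show "z \<in> {z. (cmod z)\<^sup>2 \<le> t} \<inter> unit_disc" by simp
      qed (simp add: real_le_rsqrt)
      moreover have "{0..1} \<inter> {..t} = {0..t}"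
        using 2 by auto
      moreover have "measure area (cball 0 (sqrt t)) = t"
        using 2 by (simp add: measure_def emeasure_area_cball)
      ultimately show ?thesis
        using 2 by (simp add: L R)
    next
      case 3
      have "(cmod z)\<^sup>2 \<le> t" if "cmod z < 1" for z
        using power_le_one[of "cmod z" 2] that 3 by simp
      then have "{z. (cmod z)\<^sup>2 \<le> t} \<inter> unit_disc = unit_disc"
        by auto
      moreover have "{0..1} \<inter> {..t} = {0..1}"
        using 3 by auto
      ultimately show ?thesis
        by (simp add: L R measure_def emeasure_area_disc)
    qed
  qed
qed

lemma integral_area_radial:
  fixes \<phi> :: "real \<Rightarrow> real"
  assumes [measurable]: "\<phi> \<in> borel_measurable borel"
  shows "(\<integral>z. \<phi> ((cmod z)\<^sup>2) \<partial>area) = (\<integral>t. indicator {0..1} t *\<^sub>R \<phi> t \<partial>lborel)"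
proof -
  have "(\<integral>z. \<phi> ((cmod z)\<^sup>2) \<partial>area) = integral\<^sup>L (uniform_measure lborel {0..1}) \<phi>"
    unfolding distr_area_norm_square[symmetric] by (subst integral_distr) auto
  also have "\<dots> = (\<integral>t. indicator {0..1} t *\<^sub>R \<phi> t \<partial>lborel)"
  proof -
    have "uniform_measure lborel {0..1::real} = density lborel (\<lambda>t. ennreal (indicator {0..1} t))"
      unfolding uniform_measure_def by (simp add: ennreal_indicator divide_ennreal_def)
    then show ?thesis
      by (simp add: integral_density)
  qed
  finally show ?thesis .
qed

section \<open>Moments of discs\<close>

text \<open>
  Rotating by a suitable angle multiplies the integrand by \<open>-1\<close> and leaves the integral unchanged.
\<close>

lemma integral_area_monomials_diff:
  assumes "m \<noteq> n"
  shows "(LINT z:ball 0 r|area. z ^ m * cnj z ^ n) = 0"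
proof -
  define c where "c = cis (pi / (real m - real n))"
  let ?h = "\<lambda>z. indicator (ball 0 r) z *\<^sub>R (z ^ m * cnj z ^ n)"
  have "c ^ m * cnj c ^ n = cis (real m * (pi / (real m - real n)) + real n * - (pi / (real m - real n)))"
    unfolding c_def cis_cnj Complex.DeMoivre cis_mult ..
  also have "real m * (pi / (real m - real n)) + real n * - (pi / (real m - real n)) = pi"
  proof -
    have "real m * (pi / (real m - real n)) + real n * - (pi / (real m - real n)) =
        (real m - real n) * (pi / (real m - real n))"
      by (simp add: left_diff_distrib del: times_divide_eq_right)
    then show ?thesis
      using assms by simp
  qed
  finally have c: "c ^ m * cnj c ^ n = -1"
    by simp
  have [simp]: "cmod c = 1" by (simp add: c_def)
  have "integral\<^sup>L area ?h = (\<integral>z. ?h (c * z) \<partial>area)"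
  proof (rule integral_area_rotation[symmetric])
    show "?h \<in> borel_measurable borel"
      by (intro borel_measurable_scaleR borel_measurable_indicator borel_measurable_continuous_onI
        continuous_intros) simp
  qed simp
  also have "\<dots> = (\<integral>z. (c ^ m * cnj c ^ n) * ?h z \<partial>area)"
    by (intro Bochner_Integration.integral_cong refl)
      (auto simp: indicator_def norm_mult power_mult_distrib)
  also have "\<dots> = - integral\<^sup>L area ?h"
    by (simp only: c) simp
  finally show ?thesis
    by (simp add: set_lebesgue_integral_def)
qed

lemma integral_area_monomials_same:
  assumes "0 \<le> r" "r < 1"
  shows "(LINT z:ball 0 r|area. z ^ n * cnj z ^ n) = of_real (r ^ (2 * n + 2) / (n + 1))"
proof -
  have "(LINT z:ball 0 r|area. z ^ n * cnj z ^ n) =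
      (\<integral>z. of_real (indicator {..<r\<^sup>2} ((cmod z)\<^sup>2) * ((cmod z)\<^sup>2) ^ n) \<partial>area)"
    unfolding set_lebesgue_integral_def using assms
  proof (intro Bochner_Integration.integral_cong refl)
    fix z :: complex
    have "z ^ n * cnj z ^ n = of_real (((cmod z)\<^sup>2) ^ n)"
      by (simp only: complex_norm_square of_real_power[of "(cmod z)\<^sup>2" n] power_mult_distrib)
    moreover have "(cmod z)\<^sup>2 < r\<^sup>2 \<longleftrightarrow> cmod z < r"
      using power_mono_iff[of r "cmod z" 2] assms by (simp flip: not_le)
    ultimately show "indicator (ball 0 r) z *\<^sub>R (z ^ n * cnj z ^ n) =
        of_real (indicator {..<r\<^sup>2} ((cmod z)\<^sup>2) * ((cmod z)\<^sup>2) ^ n)"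
      by (simp add: indicator_def)
  qed
  also have "\<dots> = of_real (\<integral>z. indicator {..<r\<^sup>2} ((cmod z)\<^sup>2) * ((cmod z)\<^sup>2) ^ n \<partial>area)"
    by (rule integral_complex_of_real)
  also have "(\<integral>z. indicator {..<r\<^sup>2} ((cmod z)\<^sup>2) * ((cmod z)\<^sup>2) ^ n \<partial>area) =
      (\<integral>t. indicator {0..1} t *\<^sub>R (indicator {..<r\<^sup>2} t * t ^ n) \<partial>lborel)"
    by (rule integral_area_radial) measurable
  also have "\<dots> = (\<integral>t. indicator {0..r\<^sup>2} t *\<^sub>R t ^ n \<partial>lborel)"
  proof (rule integral_cong_AE)
    have "r\<^sup>2 < 1" using assms by (simp add: power_less_one_iff abs_square_less_1)
    show "AE t in lborel. indicator {0..1} t *\<^sub>R (indicator {..<r\<^sup>2} t * t ^ n) =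
        indicator {0..r\<^sup>2} t *\<^sub>R t ^ n"
      using AE_lborel_singleton[of "r\<^sup>2"] by (rule eventually_mono)
        (use \<open>r\<^sup>2 < 1\<close> in \<open>auto simp: indicator_def\<close>)
  qed measurable
  also have "\<dots> = (r\<^sup>2) ^ (n + 1) / (n + 1)"
    using integral_power[of 0 "r\<^sup>2" n] by (simp add: mult_ac add_ac)
  finally show ?thesis
    using power_mult[of r 2 "n + 1"] by simp
qed

section \<open>Pairings of power series\<close>

lemma borel_measurable_cnj [measurable (raw)]:
  "f \<in> borel_measurable M \<Longrightarrow> (\<lambda>x. cnj (f x)) \<in> borel_measurable M"
  by (rule borel_measurable_continuous_on[of cnj]) (intro continuous_intros)

text \<open>
  Dominated convergence for series, in the form used throughout: the power series converges
  absolutely and uniformly on the disc that carries \<open>\<phi>\<close>. The measure is arbitrary and the radius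
  \<open>\<rho> = 1\<close> is possible, so that the lemma also applies to integrands that are merely integrable over
  the unit disc.
\<close>

lemma integral_cnj_powser_sums:
  fixes \<phi> :: "complex \<Rightarrow> complex"
  assumes \<phi>: "integrable \<mu> \<phi>" and id: "(\<lambda>z. z) \<in> borel_measurable \<mu>"
    and supp: "AE z in \<mu>. \<phi> z \<noteq> 0 \<longrightarrow> cmod z \<le> \<rho>" and "0 \<le> \<rho>"
    and b: "summable (\<lambda>n. cmod (b n) * \<rho> ^ n)"
  shows "(\<lambda>n. cnj (b n) * (\<integral>z. \<phi> z * cnj z ^ n \<partial>\<mu>)) sums (\<integral>z. \<phi> z * cnj (\<Sum>n. b n * z ^ n) \<partial>\<mu>)"
proof -
  note [measurable] = borel_measurable_integrable[OF \<phi>]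
  have [measurable]: "(\<lambda>z. z ^ n) \<in> borel_measurable \<mu>" "(\<lambda>z. cnj z ^ n) \<in> borel_measurable \<mu>" for n
    by (intro borel_measurable_power borel_measurable_cnj id)+
  let ?f = "\<lambda>n z. cnj (b n) * (\<phi> z * cnj z ^ n)"
  have bound: "AE z in \<mu>. norm (?f n z) \<le> cmod (b n) * \<rho> ^ n * cmod (\<phi> z)" for n
    using supp
  proof eventually_elim
    case (elim z)
    show ?case
    proof (cases "\<phi> z = 0")
      case False
      with elim have "cmod (b n) * cmod z ^ n * cmod (\<phi> z) \<le> cmod (b n) * \<rho> ^ n * cmod (\<phi> z)"
        by (intro mult_right_mono mult_left_mono power_mono) auto
      then show ?thesis
        by (simp add: norm_mult norm_power mult_ac)
    qed simp
  qed
  have sum: "AE z in \<mu>. summable (\<lambda>n. norm (?f n z))"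
    using AE_all_countable[THEN iffD2, OF allI, OF bound]
  proof (rule eventually_mono)
    fix z assume elim: "\<forall>n. norm (?f n z) \<le> cmod (b n) * \<rho> ^ n * cmod (\<phi> z)"
    have "summable (\<lambda>n. cmod (b n) * \<rho> ^ n * cmod (\<phi> z))"
      by (rule summable_mult2[OF b])
    then show "summable (\<lambda>n. norm (?f n z))"
      by (rule summable_comparison_test') (use elim in simp)
  qed
  have int: "integrable \<mu> (?f n)" for n
  proof (rule Bochner_Integration.integrable_bound)
    show "integrable \<mu> (\<lambda>z. cmod (b n) * \<rho> ^ n * cmod (\<phi> z))"
      using \<phi> by simp
    show "AE z in \<mu>. norm (?f n z) \<le> norm (cmod (b n) * \<rho> ^ n * cmod (\<phi> z))"
      using bound[of n] by eventually_elim (use \<open>0 \<le> \<rho>\<close> in simp)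
  qed measurable
  have sumint: "summable (\<lambda>n. \<integral>z. norm (?f n z) \<partial>\<mu>)"
  proof (rule summable_comparison_test')
    show "summable (\<lambda>n. cmod (b n) * \<rho> ^ n * (\<integral>z. cmod (\<phi> z) \<partial>\<mu>))"
      by (rule summable_mult2[OF b])
    fix n
    have "(\<integral>z. norm (?f n z) \<partial>\<mu>) \<le> (\<integral>z. cmod (b n) * \<rho> ^ n * cmod (\<phi> z) \<partial>\<mu>)"
      using bound[of n] int[of n] \<phi> by (intro integral_mono_AE) auto
    then show "norm (\<integral>z. norm (?f n z) \<partial>\<mu>) \<le> cmod (b n) * \<rho> ^ n * (\<integral>z. cmod (\<phi> z) \<partial>\<mu>)"
      by simp
  qed
  have "(\<lambda>n. integral\<^sup>L \<mu> (?f n)) sums (\<integral>z. (\<Sum>n. ?f n z) \<partial>\<mu>)"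
    by (rule sums_integral[OF int sum sumint])
  also have "(\<integral>z. (\<Sum>n. ?f n z) \<partial>\<mu>) = (\<integral>z. \<phi> z * cnj (\<Sum>n. b n * z ^ n) \<partial>\<mu>)"
  proof (rule integral_cong_AE)
    show "AE z in \<mu>. (\<Sum>n. ?f n z) = \<phi> z * cnj (\<Sum>n. b n * z ^ n)"
      using supp
    proof eventually_elim
      case (elim z)
      show ?case
      proof (cases "\<phi> z = 0")
        case False
        with elim have "summable (\<lambda>n. b n * z ^ n)"
          by (intro summable_comparison_test'[OF b])
            (auto simp: norm_mult norm_power intro!: mult_left_mono power_mono)
        then have "(\<lambda>n. \<phi> z * cnj (b n * z ^ n)) sums (\<phi> z * cnj (\<Sum>n. b n * z ^ n))"
          by (intro sums_mult) (simp only: sums_cnj summable_sums)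
        then show ?thesis
          by (simp add: sums_iff mult_ac)
      qed simp
    qed
  qed measurable
  finally show ?thesis
    by simp
qed

lemma integrable_area_ball_bounded:
  fixes h :: "complex \<Rightarrow> complex"
  assumes [measurable]: "h \<in> borel_measurable borel" and "\<And>z. cmod z < r \<Longrightarrow> cmod (h z) \<le> B" and "0 \<le> B"
  shows "integrable area (\<lambda>z. indicator (ball 0 r) z *\<^sub>R h z)"
  by (rule area.integrable_const_bound[where B=B]) (use assms in \<open>auto simp: indicator_def\<close>)

lemma borel_measurable_powser [measurable]:
  "(\<lambda>z::complex. \<Sum>n. a n * z ^ n) \<in> borel_measurable borel"
  by measurable

text \<open>
  Parseval's formula on the disc of radius \<open>r\<close>. Both series are integrated term by term, one after
  the other, and orthogonality leaves only the diagonal.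
\<close>

lemma integral_area_powser_pairing:
  fixes a b :: "nat \<Rightarrow> complex"
  assumes r: "0 \<le> r" "r < 1"
    and a: "summable (\<lambda>n. cmod (a n) * r ^ n)" and b: "summable (\<lambda>n. cmod (b n) * r ^ n)"
  shows "(\<lambda>n. a n * cnj (b n) * of_real (r ^ (2 * n + 2) / (n + 1))) sums
    (LINT z:ball 0 r|area. (\<Sum>n. a n * z ^ n) * cnj (\<Sum>n. b n * z ^ n))"
proof -
  let ?i = "\<lambda>z. indicator (ball 0 r) z :: real"
  have id: "(\<lambda>z. z) \<in> borel_measurable area" by measurable
  have coeff: "(\<integral>z. (?i z *\<^sub>R (\<Sum>n. a n * z ^ n)) * cnj z ^ m \<partial>area) =
      a m * of_real (r ^ (2 * m + 2) / (m + 1))" for m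
  proof -
    have "integrable area (\<lambda>z. ?i z *\<^sub>R z ^ m)"
      using r by (intro integrable_area_ball_bounded[where B=1]) (auto simp: norm_power intro: power_le_one)
    then have "(\<lambda>n. cnj (a n) * (\<integral>z. (?i z *\<^sub>R z ^ m) * cnj z ^ n \<partial>area)) sums
        (\<integral>z. (?i z *\<^sub>R z ^ m) * cnj (\<Sum>n. a n * z ^ n) \<partial>area)"
      by (rule integral_cnj_powser_sums[where \<rho>=r, OF _ id])
        (use r a in \<open>auto simp: indicator_def\<close>)
    also have "(\<lambda>n. cnj (a n) * (\<integral>z. (?i z *\<^sub>R z ^ m) * cnj z ^ n \<partial>area)) =
        (\<lambda>n. if n = m then cnj (a m) * of_real (r ^ (2 * m + 2) / (m + 1)) else 0)"
      using integral_area_monomials_same[OF r, of m] integral_area_monomials_diff[of m _ r]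
      by (auto simp: set_lebesgue_integral_def)
    finally have "(\<integral>z. (?i z *\<^sub>R z ^ m) * cnj (\<Sum>n. a n * z ^ n) \<partial>area) =
        cnj (a m) * of_real (r ^ (2 * m + 2) / (m + 1))"
      by (rule sums_unique2) (rule sums_single)
    then have "cnj (\<integral>z. (?i z *\<^sub>R z ^ m) * cnj (\<Sum>n. a n * z ^ n) \<partial>area) =
        a m * of_real (r ^ (2 * m + 2) / (m + 1))"
      by simp
    then show ?thesis
      by (subst (asm) Bochner_Integration.integral_cnj[symmetric]) (simp add: mult_ac)
  qed
  have "integrable area (\<lambda>z. ?i z *\<^sub>R (\<Sum>n. a n * z ^ n))"
  proof (rule integrable_area_ball_bounded)
    fix z :: complex assume "cmod z < r"
    then have le: "cmod (a n * z ^ n) \<le> cmod (a n) * r ^ n" for n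
      by (auto simp: norm_mult norm_power intro!: mult_left_mono power_mono)
    then have "summable (\<lambda>n. cmod (a n * z ^ n))"
      by (intro summable_comparison_test'[OF a]) simp
    then show "cmod (\<Sum>n. a n * z ^ n) \<le> (\<Sum>n. cmod (a n) * r ^ n)"
      using le a by (intro order.trans[OF summable_norm] suminf_le) auto
  qed (use r a in \<open>auto intro: suminf_nonneg\<close>)
  then have "(\<lambda>n. cnj (b n) * (\<integral>z. (?i z *\<^sub>R (\<Sum>n. a n * z ^ n)) * cnj z ^ n \<partial>area)) sums
      (\<integral>z. (?i z *\<^sub>R (\<Sum>n. a n * z ^ n)) * cnj (\<Sum>n. b n * z ^ n) \<partial>area)"
    by (rule integral_cnj_powser_sums[where \<rho>=r, OF _ id])
      (use r b in \<open>auto simp: indicator_def\<close>)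
  then show ?thesis
    unfolding coeff by (simp add: set_lebesgue_integral_def mult_ac)
qed

section \<open>The pairing of a Bergman projection over smaller discs\<close>

text \<open>
  The Bergman kernel \<open>(1 - z cnj(w))\<^bsup>-2\<^esup>\<close> is the conjugate of \<open>\<Sum>\<^sub>n (n + 1) (cnj(z) w)\<^sup>n\<close>, a power series in
  \<open>w\<close> that converges absolutely up to the unit circle when \<open>z\<close> is fixed.
\<close>

lemma bergman_projection_sums:
  assumes f: "integrable area f" and z: "cmod z < 1"
  shows "(\<lambda>n. of_nat (Suc n) * (LINT w|area. f w * cnj w ^ n) * z ^ n) sums bergman_projection f z"
proof -
  have id: "(\<lambda>z. z) \<in> borel_measurable area" by measurable
  have "summable (\<lambda>n. norm (of_nat (Suc n) * cnj z ^ n))"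
  proof -
    have "summable (\<lambda>n. of_nat (Suc n) * cmod z ^ n)"
      using geometric_deriv_sums[of "cmod z"] z by (auto simp: sums_iff)
    then show ?thesis
      by (simp add: norm_mult norm_power del: of_nat_Suc)
  qed
  then have "(\<lambda>n. cnj (of_nat (Suc n) * cnj z ^ n) * (LINT w|area. f w * cnj w ^ n)) sums
      (LINT w|area. f w * cnj (\<Sum>n. of_nat (Suc n) * cnj z ^ n * w ^ n))"
    by (intro integral_cnj_powser_sums[where \<rho>=1, OF f id])
      (auto intro: AE_areaI simp del: of_nat_Suc)
  also have "(LINT w|area. f w * cnj (\<Sum>n. of_nat (Suc n) * cnj z ^ n * w ^ n)) = bergman_projection f z"
    unfolding bergman_projection_def
  proof (intro Bochner_Integration.integral_cong refl)
    fix w assume "w \<in> space area"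
    then have "cmod (cnj z * w) < 1"
      using z mult_strict_mono'[of "cmod z" 1 "cmod w" 1] by (simp add: norm_mult)
    then have "(\<Sum>n. of_nat (Suc n) * (cnj z * w) ^ n) = 1 / (1 - cnj z * w)\<^sup>2"
      by (rule geometric_deriv_sums[THEN sums_unique, symmetric])
    then show "f w * cnj (\<Sum>n. of_nat (Suc n) * cnj z ^ n * w ^ n) = f w / (1 - z * cnj w)\<^sup>2"
      by (simp add: power_mult_distrib mult.assoc del: of_nat_Suc)
  qed
  finally show ?thesis
    by (simp add: mult_ac del: of_nat_Suc)
qed

lemma summable_cmod_powser:
  fixes c :: "nat \<Rightarrow> complex"
  assumes "\<And>z. cmod z < 1 \<Longrightarrow> summable (\<lambda>n. c n * z ^ n)" and r: "0 \<le> r" "r < 1"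
  shows "summable (\<lambda>n. cmod (c n) * r ^ n)"
proof -
  obtain s where s: "r < s" "s < 1"
    using r dense by blast
  then have "summable (\<lambda>n. c n * of_real s ^ n)"
    using assms(1)[of "of_real s"] r by simp
  then have "summable (\<lambda>n. norm (c n * of_real r ^ n))"
    by (rule powser_insidea) (use r s in simp)
  then show ?thesis
    using r by (simp add: norm_mult norm_power)
qed

lemma has_field_derivative_powser_disc:
  fixes c :: "nat \<Rightarrow> complex"
  assumes f: "\<And>z. cmod z < 1 \<Longrightarrow> (\<lambda>n. c n * z ^ n) sums f z" and z: "cmod z < 1"
  shows "(f has_field_derivative (\<Sum>n. diffs c n * z ^ n)) (at z)"
proof (rule has_field_derivative_transform_within_open)
  show "((\<lambda>z. \<Sum>n. c n * z ^ n) has_field_derivative (\<Sum>n. diffs c n * z ^ n)) (at z)"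
    using f z by (intro termdiffs_strong'[where K=1]) (auto simp: sums_iff)
  show "open unit_disc" "z \<in> unit_disc" using z by auto
  show "(\<Sum>n. c n * z ^ n) = f z" if "z \<in> unit_disc" for z
    using f[of z] that by (simp add: sums_iff)
qed

lemma deriv_powser_disc_sums:
  fixes c :: "nat \<Rightarrow> complex"
  assumes f: "\<And>z. cmod z < 1 \<Longrightarrow> (\<lambda>n. c n * z ^ n) sums f z" and z: "cmod z < 1"
  shows "(\<lambda>n. diffs c n * z ^ n) sums deriv f z"
proof -
  have "summable (\<lambda>n. diffs c n * z ^ n)"
    by (rule termdiff_converges[where K=1]) (use f z in \<open>auto simp: sums_iff\<close>)
  then show ?thesis
    using DERIV_imp_deriv[OF has_field_derivative_powser_disc[OF f z]] by (simp add: sums_iff)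
qed

text \<open>
  Both sides are the series \<open>\<Sum>\<^sub>n (n + 2) c\<^bsub>n+1\<^esub> cnj(b\<^sub>n) r\<^bsup>2n+2\<^esup>\<close>: the left one by Parseval's formula for the
  disc of radius \<open>r\<close>, the right one by integrating the Taylor series of the derivative of
  \<open>z\<^sup>2 g'(z)\<close> term by term over the whole disc, where the dilation by \<open>r\<^sup>2\<close> makes it converge
  uniformly.
\<close>

lemma bergman_pairing_on_disc:
  assumes f: "integrable area f" and g: "g holomorphic_on unit_disc" and r: "0 \<le> r" "r < 1"
  shows "(LINT z:ball 0 r|area. deriv (bergman_projection f) z * cnj (deriv g z)) =
    (LINT w|area. f w * cnj (deriv (\<lambda>z. z\<^sup>2 * deriv g z) (of_real (r\<^sup>2) * w)))"
proof -
  have id: "(\<lambda>z. z) \<in> borel_measurable area" by measurable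
  define c where "c n = (LINT w|area. f w * cnj w ^ n)" for n
  define a where "a = diffs (\<lambda>n. of_nat (Suc n) * c n)"
  define b where "b n = (deriv ^^ n) (deriv g) 0 / fact n" for n
  define e where "e = diffs (\<lambda>n. if n < 2 then 0 else b (n - 2))"
  have a: "(\<lambda>n. a n * z ^ n) sums deriv (bergman_projection f) z" if "cmod z < 1" for z
    unfolding a_def c_def using bergman_projection_sums[OF f] that by (rule deriv_powser_disc_sums)
  have b: "(\<lambda>n. b n * z ^ n) sums deriv g z" if "cmod z < 1" for z
    using holomorphic_power_series[of "deriv g" 0 1 z] g that by (simp add: b_def holomorphic_deriv)
  have "(\<lambda>n. (if n < 2 then 0 else b (n - 2)) * z ^ n) sums (z\<^sup>2 * deriv g z)" if "cmod z < 1" for z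
  proof -
    have "(\<lambda>n. z\<^sup>2 * (b n * z ^ n)) sums (z\<^sup>2 * deriv g z)"
      by (rule sums_mult[OF b[OF that]])
    moreover have "(\<lambda>n. z\<^sup>2 * (b n * z ^ n)) =
        (\<lambda>n. (if n + 2 < 2 then 0 else b (n + 2 - 2)) * z ^ (n + 2))"
      by (simp add: power_add power2_eq_square mult_ac)
    ultimately show ?thesis
      using sums_zero_iff_shift[of 2 "\<lambda>n. (if n < 2 then 0 else b (n - 2)) * z ^ n" "z\<^sup>2 * deriv g z"]
      by simp
  qed
  then have e: "(\<lambda>n. e n * z ^ n) sums deriv (\<lambda>z. z\<^sup>2 * deriv g z) z" if "cmod z < 1" for z
    unfolding e_def using that by (rule deriv_powser_disc_sums)
  have e_simps: "e 0 = 0" "e (Suc n) = of_nat (n + 2) * b n" for n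
    by (simp_all add: e_def diffs_def)

  have "(\<lambda>n. a n * cnj (b n) * of_real (r ^ (2 * n + 2) / (n + 1))) sums
      (LINT z:ball 0 r|area. (\<Sum>n. a n * z ^ n) * cnj (\<Sum>n. b n * z ^ n))"
    using a b r by (intro integral_area_powser_pairing summable_cmod_powser) (auto simp: sums_iff)
  also have "(LINT z:ball 0 r|area. (\<Sum>n. a n * z ^ n) * cnj (\<Sum>n. b n * z ^ n)) =
      (LINT z:ball 0 r|area. deriv (bergman_projection f) z * cnj (deriv g z))"
    unfolding set_lebesgue_integral_def using a b
    by (intro Bochner_Integration.integral_cong) (auto simp: sums_iff)
  also have "(\<lambda>n. a n * cnj (b n) * of_real (r ^ (2 * n + 2) / (n + 1))) =
      (\<lambda>n. cnj (e (Suc n) * of_real (r\<^sup>2) ^ Suc n) * c (Suc n))"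
  proof
    fix n
    let ?x = "complex_of_real (r ^ (2 * n + 2) / (n + 1))"
    have a_eq: "a n = of_nat (n + 1) * (of_nat (n + 2) * c (Suc n))"
      by (simp add: a_def diffs_def algebra_simps)
    have "of_nat (n + 1) * ?x = of_real (real (n + 1) * (r ^ (2 * n + 2) / (n + 1)))"
      by (simp only: of_real_mult of_real_of_nat_eq)
    also have "real (n + 1) * (r ^ (2 * n + 2) / (n + 1)) = (r\<^sup>2) ^ Suc n"
      using power_mult[of r 2 "Suc n"] by simp
    finally have x_eq: "of_nat (n + 1) * ?x = of_real (r\<^sup>2) ^ Suc n"
      by (simp only: of_real_power)
    have "a n * cnj (b n) * ?x = of_nat (n + 2) * c (Suc n) * cnj (b n) * (of_nat (n + 1) * ?x)"
      unfolding a_eq by (simp only: mult_ac)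
    also have "\<dots> = cnj (e (Suc n) * of_real (r\<^sup>2) ^ Suc n) * c (Suc n)"
      unfolding x_eq e_simps complex_cnj_mult complex_cnj_power complex_cnj_complex_of_real
        complex_cnj_of_nat
      by (simp only: mult_ac)
    finally show "a n * cnj (b n) * ?x = cnj (e (Suc n) * of_real (r\<^sup>2) ^ Suc n) * c (Suc n)" .
  qed
  finally have "(\<lambda>n. cnj (e n * of_real (r\<^sup>2) ^ n) * c n) sums
      (LINT z:ball 0 r|area. deriv (bergman_projection f) z * cnj (deriv g z))"
    by (subst (asm) sums_Suc_iff) (simp add: e_simps)
  moreover have "(\<lambda>n. cnj (e n * of_real (r\<^sup>2) ^ n) * c n) sums
      (LINT w|area. f w * cnj (\<Sum>n. e n * of_real (r\<^sup>2) ^ n * w ^ n))"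
    unfolding c_def
  proof (rule integral_cnj_powser_sums[where \<rho>=1, OF f id])
    have "r\<^sup>2 < 1" using r by (simp add: abs_square_less_1)
    then have "summable (\<lambda>n. cmod (e n) * (r\<^sup>2) ^ n)"
      using e by (intro summable_cmod_powser) (auto simp: sums_iff)
    then show "summable (\<lambda>n. cmod (e n * of_real (r\<^sup>2) ^ n) * 1 ^ n)"
      by (simp add: norm_mult norm_power)
  qed (auto intro: AE_areaI)
  moreover have "(LINT w|area. f w * cnj (\<Sum>n. e n * of_real (r\<^sup>2) ^ n * w ^ n)) =
      (LINT w|area. f w * cnj (deriv (\<lambda>z. z\<^sup>2 * deriv g z) (of_real (r\<^sup>2) * w)))"
  proof (intro Bochner_Integration.integral_cong refl)
    fix w assume "w \<in> space area"
    then have "cmod (of_real (r\<^sup>2) * w) < 1"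
      using r mult_strict_mono'[of "r\<^sup>2" 1 "cmod w" 1] by (simp add: norm_mult norm_power abs_square_less_1)
    from e[OF this] show "f w * cnj (\<Sum>n. e n * of_real (r\<^sup>2) ^ n * w ^ n) =
        f w * cnj (deriv (\<lambda>z. z\<^sup>2 * deriv g z) (of_real (r\<^sup>2) * w))"
      by (simp add: sums_iff power_mult_distrib mult_ac)
  qed
  ultimately show ?thesis
    by (simp add: sums_iff)
qed

section \<open>The Schwarz-Pick estimate\<close>

text \<open>
  Composition with a disc automorphism that maps \<open>0\<close> to \<open>w\<close> moves the estimate to the origin, where it
  is Cauchy's inequality; the derivative of the automorphism at \<open>0\<close> is \<open>1 - |w|\<^sup>2\<close>.
\<close>

lemma Schwarz_Pick_deriv_bound:
  assumes f: "f holomorphic_on unit_disc" and B: "\<And>z. cmod z < 1 \<Longrightarrow> cmod (f z) \<le> B"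
    and w: "cmod w < 1"
  shows "(1 - (cmod w)\<^sup>2) * cmod (deriv f w) \<le> B"
proof -
  let ?m = "Moebius_function 0 (- w)"
  have m_hol: "?m holomorphic_on unit_disc" and m_less: "cmod z < 1 \<Longrightarrow> cmod (?m z) < 1" for z
    using w by (auto intro: Moebius_function_holomorphic Moebius_function_norm_lt_1)
  have m0: "?m 0 = w"
    by (simp add: Moebius_function_of_zero)
  have "(?m has_field_derivative (1 - cnj w * w)) (at 0)"
    unfolding Moebius_function_simple by (rule derivative_eq_intros refl | simp)+
  moreover have "(f has_field_derivative deriv f w) (at (?m 0))"
    using holomorphic_derivI[OF f open_ball, of w] w by (simp add: m0)
  ultimately have "((f \<circ> ?m) has_field_derivative (deriv f w * (1 - cnj w * w))) (at 0)"
    by (intro DERIV_chain)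
  then have D: "deriv (f \<circ> ?m) 0 = deriv f w * (1 - cnj w * w)"
    by (rule DERIV_imp_deriv)
  have hol: "(f \<circ> ?m) holomorphic_on unit_disc"
    by (rule holomorphic_on_compose_gen[OF m_hol f]) (use m_less in auto)
  have le: "s * cmod (deriv (f \<circ> ?m) 0) \<le> B" if s: "0 < s" "s < 1" for s
  proof -
    have "cmod ((deriv ^^ 1) (f \<circ> ?m) 0) \<le> fact 1 * B / s ^ 1"
    proof (rule Cauchy_inequality)
      show "f \<circ> ?m holomorphic_on ball 0 s"
        using s by (intro holomorphic_on_subset[OF hol]) auto
      show "continuous_on (cball 0 s) (f \<circ> ?m)"
        using s by (intro holomorphic_on_imp_continuous_on holomorphic_on_subset[OF hol]) auto
      show "cmod ((f \<circ> ?m) z) \<le> B" if "cmod (0 - z) = s" for z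
        using that s m_less[of z] by (auto intro!: B)
    qed fact
    then show ?thesis
      using s by (simp add: field_simps)
  qed
  have "1 * cmod (deriv (f \<circ> ?m) 0) \<le> B"
  proof (rule tendsto_upperbound)
    show "((\<lambda>s. s * cmod (deriv (f \<circ> ?m) 0)) \<longlongrightarrow> 1 * cmod (deriv (f \<circ> ?m) 0)) (at_left 1)"
      by (intro tendsto_intros)
    show "\<forall>\<^sub>F s in at_left 1. s * cmod (deriv (f \<circ> ?m) 0) \<le> B"
      using eventually_at_left_real[of 0 1] by (rule eventually_mono) (use le in auto)
  qed simp
  moreover have "cmod (1 - cnj w * w) = 1 - (cmod w)\<^sup>2"
  proof -
    have "1 - cnj w * w = of_real (1 - (cmod w)\<^sup>2)"
      by (simp only: of_real_diff of_real_1 complex_norm_square mult.commute)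
    then show ?thesis
      using w by (simp add: abs_square_le_1 less_imp_le del: of_real_diff)
  qed
  ultimately show ?thesis
    by (simp add: D norm_mult mult.commute)
qed

lemma deriv_bound_ball:
  assumes f: "f holomorphic_on ball 0 R" and B: "\<And>z. cmod z < R \<Longrightarrow> cmod (f z) \<le> B"
    and w: "cmod w < R"
  shows "(R\<^sup>2 - (cmod w)\<^sup>2) * cmod (deriv f w) \<le> R * B"
proof -
  have R: "0 < R" using w norm_ge_zero[of w] by linarith
  let ?h = "\<lambda>z. f (of_real R * z)"
  have sub: "(\<lambda>z. of_real R * z) ` unit_disc \<subseteq> ball 0 R"
    using R by (auto simp: norm_mult)
  have "(f \<circ> (\<lambda>z. of_real R * z)) holomorphic_on unit_disc"
    by (rule holomorphic_on_compose_gen[OF _ f sub]) (intro holomorphic_intros)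
  then have hol: "?h holomorphic_on unit_disc"
    by (simp add: o_def)
  have "deriv ?h (w / of_real R) = of_real R * deriv f w"
  proof (rule DERIV_imp_deriv)
    have "(f has_field_derivative deriv f w) (at (of_real R * (w / of_real R)))"
      using holomorphic_derivI[OF f open_ball, of w] w R by simp
    then have "((f \<circ> (\<lambda>z. of_real R * z)) has_field_derivative (deriv f w * of_real R)) (at (w / of_real R))"
      by (rule DERIV_chain) (rule derivative_eq_intros refl | simp)+
    then show "(?h has_field_derivative (of_real R * deriv f w)) (at (w / of_real R))"
      by (simp add: o_def mult.commute)
  qed
  moreover have "(1 - (cmod (w / of_real R))\<^sup>2) * cmod (deriv ?h (w / of_real R)) \<le> B"
    by (rule Schwarz_Pick_deriv_bound[OF hol]) (use B w R in \<open>auto simp: norm_mult norm_divide\<close>)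
  ultimately have "(1 - (cmod w / R)\<^sup>2) * (R * cmod (deriv f w)) \<le> B"
    using R by (simp add: norm_mult norm_divide)
  then have "R * ((1 - (cmod w / R)\<^sup>2) * (R * cmod (deriv f w))) \<le> R * B"
    using R by (intro mult_left_mono) auto
  also have "R * ((1 - (cmod w / R)\<^sup>2) * (R * cmod (deriv f w))) = (R\<^sup>2 - (cmod w)\<^sup>2) * cmod (deriv f w)"
    using R by (simp add: field_simps power2_eq_square)
  finally show ?thesis .
qed

lemma bloch_seminorm_upper:
  assumes "g \<in> bloch" "cmod z < 1"
  shows "(1 - (cmod z)\<^sup>2) * cmod (deriv g z) \<le> bloch_seminorm g"
  using assms unfolding bloch_seminorm_def bloch_def by (intro cSUP_upper) auto

lemma bloch_seminorm_nonneg: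
  assumes "g \<in> bloch"
  shows "0 \<le> bloch_seminorm g"
  using order.trans[OF _ bloch_seminorm_upper[OF assms, of 0]] by simp

section \<open>The symbol of the adjoint and its bound\<close>

text \<open>
  The explicit form of \<open>P\<^sup>* g\<close>. The factor \<open>(1 - |w|\<^sup>2)\<^sup>2\<close> cancels the density of the invariant measure
  with respect to \<open>dA\<close>.
\<close>

definition adjoint_symbol :: "(complex \<Rightarrow> complex) \<Rightarrow> complex \<Rightarrow> complex" where
  "adjoint_symbol g w = of_real ((1 - (cmod w)\<^sup>2)\<^sup>2) * deriv (\<lambda>z. z\<^sup>2 * deriv g z) w"

lemma holomorphic_square_times_deriv:
  assumes "g holomorphic_on unit_disc"
  shows "(\<lambda>z. z\<^sup>2 * deriv g z) holomorphic_on unit_disc"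
  using assms by (intro holomorphic_intros) auto

text \<open>
  The Schwarz-Pick estimate for \<open>z\<^sup>2 g'(z)\<close> on a disc of radius \<open>R < 1\<close>. A larger \<open>R\<close> weakens the bound
  of the function and strengthens the estimate of its derivative in terms of that bound.
\<close>

lemma weighted_deriv_square_times_deriv_le:
  assumes g: "g \<in> bloch" and w: "cmod w < 1"
  shows "(1 - (cmod w)\<^sup>2)\<^sup>2 * cmod (deriv (\<lambda>z. z\<^sup>2 * deriv g z) w) \<le> 4 * bloch_seminorm g"
proof -
  let ?G = "\<lambda>z. z\<^sup>2 * deriv g z" and ?N = "bloch_seminorm g"
  \<comment> \<open>This choice balances \<open>1 - R\<^sup>2\<close> and \<open>R\<^sup>2 - |w|\<^sup>2\<close>: both equal \<open>(1 - |w|\<^sup>2) / 2\<close>, and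
    their product is then largest.\<close>
  define R where "R = sqrt ((1 + (cmod w)\<^sup>2) / 2)"
  have w2: "(cmod w)\<^sup>2 < 1" using w by (simp add: abs_square_less_1)
  have R2: "R\<^sup>2 = (1 + (cmod w)\<^sup>2) / 2" by (simp add: R_def)
  have R: "0 \<le> R" "R < 1" "cmod w < R"
  proof -
    show "0 \<le> R" by (simp add: R_def)
    then show "R < 1" "cmod w < R"
      using w2 R2 by (auto intro: power2_less_imp_less)
  qed
  have N: "0 \<le> ?N" by (rule bloch_seminorm_nonneg[OF g])
  have B: "cmod (?G z) \<le> ?N / (1 - R\<^sup>2)" if z: "cmod z < R" for z
  proof -
    have zR: "(cmod z)\<^sup>2 \<le> R\<^sup>2" using z by (intro power_mono) auto
    have "(1 - R\<^sup>2) * cmod (?G z) \<le> (1 - (cmod z)\<^sup>2) * cmod (deriv g z)"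
    proof (rule mult_mono)
      have "cmod z ^ 2 * cmod (deriv g z) \<le> 1 * cmod (deriv g z)"
        using z R by (intro mult_right_mono power_le_one) auto
      then show "cmod (?G z) \<le> cmod (deriv g z)"
        by (simp add: norm_mult norm_power)
    qed (use zR R2 w2 in auto)
    also have "\<dots> \<le> ?N" using z R by (intro bloch_seminorm_upper[OF g]) auto
    finally have "(1 - R\<^sup>2) * cmod (?G z) \<le> ?N" .
    moreover have "0 < 1 - R\<^sup>2" using R2 w2 by simp
    ultimately show ?thesis
      by (simp add: pos_le_divide_eq mult.commute)
  qed
  have hol: "?G holomorphic_on ball 0 R"
    using g R by (intro holomorphic_on_subset[OF holomorphic_square_times_deriv]) (auto simp: bloch_def)
  have "(R\<^sup>2 - (cmod w)\<^sup>2) * cmod (deriv ?G w) \<le> R * (?N / (1 - R\<^sup>2))"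
    by (rule deriv_bound_ball[OF hol B R(3)])
  also have "\<dots> \<le> ?N / (1 - R\<^sup>2)"
    using R R2 w2 N mult_right_mono[of R 1 "?N / (1 - R\<^sup>2)"] by simp
  finally have "(1 - (cmod w)\<^sup>2) / 2 * cmod (deriv ?G w) \<le> ?N / ((1 - (cmod w)\<^sup>2) / 2)"
    unfolding R2 by (simp add: field_simps)
  then show ?thesis
    using w2 by (simp add: field_simps power2_eq_square)
qed

lemma norm_adjoint_symbol_le:
  assumes "g \<in> bloch" "cmod w < 1"
  shows "cmod (adjoint_symbol g w) \<le> 4 * bloch_seminorm g"
  using weighted_deriv_square_times_deriv_le[OF assms] by (simp add: adjoint_symbol_def norm_mult del: of_real_diff of_real_power)

lemma continuous_on_adjoint_symbol:
  assumes "g holomorphic_on unit_disc"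
  shows "continuous_on unit_disc (adjoint_symbol g)"
  unfolding adjoint_symbol_def
  by (intro continuous_intros holomorphic_on_imp_continuous_on holomorphic_deriv
      holomorphic_square_times_deriv assms) auto

section \<open>The invariant measure and the essential supremum norm\<close>

lemma weight_pos: "cmod z < 1 \<Longrightarrow> 0 < (1 - (cmod z)\<^sup>2)\<^sup>2"
  using abs_square_less_1[of "cmod z"] by simp

lemma borel_measurable_weight [measurable]:
  "(\<lambda>z. 1 / (1 - (cmod z)\<^sup>2)\<^sup>2) \<in> borel_measurable area"
  by (rule borel_measurable_areaI) measurable

lemma integrable_moebius_iff:
  fixes f :: "complex \<Rightarrow> complex"
  shows "integrable moebius_measure f \<longleftrightarrow>
    f \<in> borel_measurable area \<and> integrable area (\<lambda>z. f z / of_real ((1 - (cmod z)\<^sup>2)\<^sup>2))"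
proof (cases "f \<in> borel_measurable area")
  case True
  then have "integrable moebius_measure f \<longleftrightarrow> integrable area (\<lambda>z. (1 / (1 - (cmod z)\<^sup>2)\<^sup>2) *\<^sub>R f z)"
    unfolding moebius_measure_def by (intro integrable_density) auto
  also have "(\<lambda>z. (1 / (1 - (cmod z)\<^sup>2)\<^sup>2) *\<^sub>R f z) = (\<lambda>z. f z / of_real ((1 - (cmod z)\<^sup>2)\<^sup>2))"
    by (simp add: scaleR_conv_of_real)
  finally show ?thesis using True by simp
next
  case False
  then show ?thesis
    by (auto dest!: borel_measurable_integrable simp: moebius_measure_def)
qed

lemma integral_moebius:
  fixes h :: "complex \<Rightarrow> complex"
  assumes [measurable]: "h \<in> borel_measurable area"
  shows "integral\<^sup>L moebius_measure h = (\<integral>z. h z / of_real ((1 - (cmod z)\<^sup>2)\<^sup>2) \<partial>area)"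
proof -
  have "integral\<^sup>L moebius_measure h = (\<integral>z. (1 / (1 - (cmod z)\<^sup>2)\<^sup>2) *\<^sub>R h z \<partial>area)"
    unfolding moebius_measure_def by (intro integral_density) auto
  then show ?thesis
    by (simp add: scaleR_conv_of_real)
qed

lemma integrable_moebius_imp_area:
  fixes f :: "complex \<Rightarrow> complex"
  assumes "integrable moebius_measure f"
  shows "integrable area f"
proof -
  have [measurable]: "f \<in> borel_measurable area" and
    int: "integrable area (\<lambda>z. f z / of_real ((1 - (cmod z)\<^sup>2)\<^sup>2))"
    using assms by (auto simp: integrable_moebius_iff)
  show ?thesis
  proof (rule Bochner_Integration.integrable_bound[OF int])
    show "AE z in area. norm (f z) \<le> norm (f z / of_real ((1 - (cmod z)\<^sup>2)\<^sup>2))"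
    proof (rule AE_areaI)
      fix z :: complex assume z: "cmod z < 1"
      have "(1 - (cmod z)\<^sup>2)\<^sup>2 \<le> 1"
        using z by (intro power_le_one) (auto simp: abs_square_le_1 less_imp_le)
      then have "norm (f z) * (1 - (cmod z)\<^sup>2)\<^sup>2 \<le> norm (f z) * 1"
        by (intro mult_left_mono) auto
      then show "norm (f z) \<le> norm (f z / of_real ((1 - (cmod z)\<^sup>2)\<^sup>2))"
        using weight_pos[OF z] by (simp add: norm_divide pos_le_divide_eq del: of_real_power of_real_diff)
    qed
  qed measurable
qed

lemma Linf_AE_bounded:
  assumes "u \<in> Linf"
  obtains B where "AE z in area. cmod (u z) \<le> B" "0 \<le> B"
proof -
  have "Linf_norm u < \<infinity>" using assms by (simp add: Linf_def)
  then obtain B :: real where B: "Linf_norm u \<le> ereal B"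
    by (cases "Linf_norm u") auto
  have "AE z in area. ereal (cmod (u z)) \<le> Linf_norm u"
    unfolding Linf_norm_def by (rule esssup_AE)
  then have "AE z in area. cmod (u z) \<le> max B 0"
    by eventually_elim (use B in \<open>auto simp: le_max_iff_disj dest: order.trans\<close>)
  then show thesis
    by (rule that) simp
qed

lemma Linf_norm_leI:
  assumes "u \<in> borel_measurable area" "AE z in area. cmod (u z) \<le> B"
  shows "Linf_norm u \<le> ereal B"
  unfolding Linf_norm_def using assms by (intro esssup_I) auto

lemma Linf_norm_cong_AE:
  assumes "u \<in> borel_measurable area" "v \<in> borel_measurable area" "AE z in area. u z = v z"
  shows "Linf_norm u = Linf_norm v"
  unfolding Linf_norm_def using assms(1,2)
  by (intro esssup_AE_cong) (use assms(3) in \<open>auto elim: eventually_mono\<close>)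

lemma borel_measurable_adjoint_symbol [measurable]:
  "g \<in> bloch \<Longrightarrow> adjoint_symbol g \<in> borel_measurable area"
  by (intro borel_measurable_area_continuous_on continuous_on_adjoint_symbol) (simp add: bloch_def)

lemma adjoint_symbol_in_Linf:
  assumes g: "g \<in> bloch"
  shows "adjoint_symbol g \<in> Linf" "Linf_norm (adjoint_symbol g) \<le> ereal (4 * bloch_seminorm g)"
proof -
  show *: "Linf_norm (adjoint_symbol g) \<le> ereal (4 * bloch_seminorm g)"
    using norm_adjoint_symbol_le[OF g] g by (intro Linf_norm_leI) (auto intro: AE_areaI)
  show "adjoint_symbol g \<in> Linf"
    unfolding Linf_def using le_less_trans[OF *, of \<infinity>] g by simp
qed

section \<open>The symbol represents the adjoint\<close>

text \<open>
  Dominated convergence. Since \<open>1 - |w|\<^sup>2 \<le> 1 - |r\<^sup>2 w|\<^sup>2\<close>, the weighted bound of the symbol at \<open>r\<^sup>2 w\<close>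
  bounds the integrand at \<open>w\<close> by \<open>4 \<parallel>g\<parallel> |f(w)| (1 - |w|\<^sup>2)\<^bsup>-2\<^esup>\<close> for all \<open>r\<close>, and this is integrable
  exactly because \<open>f\<close> is integrable for the invariant measure.
\<close>

lemma tendsto_integral_dilated_symbol:
  assumes g: "g \<in> bloch" and f: "integrable moebius_measure f"
  defines "G' \<equiv> deriv (\<lambda>z. z\<^sup>2 * deriv g z)"
  shows "((\<lambda>r. LINT w|area. f w * cnj (G' (of_real (r\<^sup>2) * w))) \<longlongrightarrow>
    (LINT w|area. f w * cnj (G' w))) (at_left 1)"
proof (rule tendsto_at_left_sequentially[of 0 1])
  fix S :: "nat \<Rightarrow> real"
  assume S: "\<And>n. S n < 1" "\<And>n. 0 < S n" "S \<longlonglongrightarrow> 1"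
  have [measurable]: "f \<in> borel_measurable area" and
    int: "integrable area (\<lambda>z. f z / of_real ((1 - (cmod z)\<^sup>2)\<^sup>2))"
    using f by (auto simp: integrable_moebius_iff)
  have G': "continuous_on unit_disc G'"
    using g unfolding G'_def
    by (intro holomorphic_on_imp_continuous_on holomorphic_deriv holomorphic_square_times_deriv) (auto simp: bloch_def)
  have S1: "(S n)\<^sup>2 < 1" for n
    using S(1,2)[of n] by (simp add: abs_square_less_1)
  have in_disc: "cmod (of_real ((S n)\<^sup>2) * w) < 1" "cmod (of_real ((S n)\<^sup>2) * w) \<le> cmod w"
    if "cmod w < 1" for w n
  proof -
    have "(S n)\<^sup>2 * cmod w \<le> 1 * cmod w"
      using S1[of n] by (intro mult_right_mono) auto
    then show "cmod (of_real ((S n)\<^sup>2) * w) \<le> cmod w"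
      by (simp add: norm_mult norm_power)
    then show "cmod (of_real ((S n)\<^sup>2) * w) < 1" using that by simp
  qed
  have [measurable]: "G' \<in> borel_measurable area"
    by (rule borel_measurable_area_continuous_on[OF G'])
  have "continuous_on unit_disc (\<lambda>w. G' (of_real ((S n)\<^sup>2) * w))" for n
    by (rule continuous_on_compose2[OF G']) (use in_disc in \<open>auto intro!: continuous_intros\<close>)
  then have [measurable]: "(\<lambda>w. G' (of_real ((S n)\<^sup>2) * w)) \<in> borel_measurable area" for n
    by (rule borel_measurable_area_continuous_on)
  show "(\<lambda>n. LINT w|area. f w * cnj (G' (of_real ((S n)\<^sup>2) * w))) \<longlonglongrightarrow> (LINT w|area. f w * cnj (G' w))"
  proof (rule integral_dominated_convergence)
    show "integrable area (\<lambda>w. 4 * bloch_seminorm g * cmod (f w / of_real ((1 - (cmod w)\<^sup>2)\<^sup>2)))"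
      using int by (intro integrable_mult_right integrable_norm)
    show "AE w in area. (\<lambda>n. f w * cnj (G' (of_real ((S n)\<^sup>2) * w))) \<longlonglongrightarrow> f w * cnj (G' w)"
    proof (rule AE_areaI)
      fix w :: complex assume w: "cmod w < 1"
      have "(\<lambda>n. of_real ((S n)\<^sup>2) * w) \<longlonglongrightarrow> of_real (1\<^sup>2) * w"
        by (intro tendsto_intros S)
      then have "(\<lambda>n. of_real ((S n)\<^sup>2) * w) \<longlonglongrightarrow> w" by simp
      then have "(\<lambda>n. G' (of_real ((S n)\<^sup>2) * w)) \<longlonglongrightarrow> G' w"
        by (rule continuous_on_tendsto_compose[OF G']) (use w in_disc in auto)
      then show "(\<lambda>n. f w * cnj (G' (of_real ((S n)\<^sup>2) * w))) \<longlonglongrightarrow> f w * cnj (G' w)"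
        by (intro tendsto_intros)
    qed
    show "AE w in area. norm (f w * cnj (G' (of_real ((S n)\<^sup>2) * w))) \<le>
        4 * bloch_seminorm g * cmod (f w / of_real ((1 - (cmod w)\<^sup>2)\<^sup>2))" for n
    proof (rule AE_areaI)
      fix w :: complex assume w: "cmod w < 1"
      let ?v = "of_real ((S n)\<^sup>2) * w"
      have "(1 - (cmod w)\<^sup>2)\<^sup>2 * cmod (G' ?v) \<le> (1 - (cmod ?v)\<^sup>2)\<^sup>2 * cmod (G' ?v)"
        using w in_disc[OF w, of n]
        by (intro mult_right_mono power_mono diff_left_mono) (auto simp: abs_square_le_1 less_imp_le)
      also have "\<dots> \<le> 4 * bloch_seminorm g"
        unfolding G'_def by (rule weighted_deriv_square_times_deriv_le[OF g in_disc(1)[OF w]])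
      finally have "cmod (G' ?v) \<le> 4 * bloch_seminorm g / (1 - (cmod w)\<^sup>2)\<^sup>2"
        using weight_pos[OF w] by (simp add: pos_le_divide_eq mult.commute)
      then have "cmod (f w) * cmod (G' ?v) \<le> cmod (f w) * (4 * bloch_seminorm g / (1 - (cmod w)\<^sup>2)\<^sup>2)"
        by (intro mult_left_mono) auto
      then show "norm (f w * cnj (G' ?v)) \<le>
          4 * bloch_seminorm g * cmod (f w / of_real ((1 - (cmod w)\<^sup>2)\<^sup>2))"
        by (simp add: norm_mult norm_divide mult_ac del: of_real_power of_real_diff)
    qed
  qed measurable
qed simp

lemma is_adjoint_value_adjoint_symbol:
  assumes g: "g \<in> bloch"
  shows "is_adjoint_value g (adjoint_symbol g)"
  unfolding is_adjoint_value_def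
proof (intro conjI ballI adjoint_symbol_in_Linf g)
  fix f assume "f \<in> L1_moebius"
  then have f: "integrable moebius_measure f" by (simp add: L1_moebius_def)
  then have fa: "integrable area f" by (rule integrable_moebius_imp_area)
  note [measurable] = borel_measurable_integrable[OF fa] borel_measurable_adjoint_symbol[OF g]
  let ?G' = "deriv (\<lambda>z. z\<^sup>2 * deriv g z)"
  have eq: "(LINT w|area. f w * cnj (?G' w)) = (LINT z|moebius_measure. f z * cnj (adjoint_symbol g z))"
  proof (subst integral_moebius)
    show "(LINT w|area. f w * cnj (?G' w)) =
        (LINT z|area. f z * cnj (adjoint_symbol g z) / of_real ((1 - (cmod z)\<^sup>2)\<^sup>2))"
    proof (intro Bochner_Integration.integral_cong refl)
      fix w assume "w \<in> space area"
      then have "of_real ((1 - (cmod w)\<^sup>2)\<^sup>2) \<noteq> (0::complex)"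
        using weight_pos[of w] by (simp only: of_real_eq_0_iff) auto
      then show "f w * cnj (?G' w) = f w * cnj (adjoint_symbol g w) / of_real ((1 - (cmod w)\<^sup>2)\<^sup>2)"
        unfolding adjoint_symbol_def complex_cnj_mult complex_cnj_complex_of_real
        by (simp del: of_real_power of_real_diff)
    qed
  qed measurable
  have "((\<lambda>r. LINT w|area. f w * cnj (?G' (of_real (r\<^sup>2) * w))) \<longlongrightarrow>
      (LINT z|moebius_measure. f z * cnj (adjoint_symbol g z))) (at_left 1)"
    unfolding eq[symmetric] by (rule tendsto_integral_dilated_symbol[OF g f])
  then show "has_invariant_pairing (bergman_projection f) g
      (LINT z|moebius_measure. f z * cnj (adjoint_symbol g z))"
    unfolding has_invariant_pairing_def
  proof (rule Lim_transform_eventually)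
    show "\<forall>\<^sub>F r in at_left 1. (LINT w|area. f w * cnj (?G' (of_real (r\<^sup>2) * w))) =
        (LINT z:ball 0 r|area. deriv (bergman_projection f) z * cnj (deriv g z))"
      using eventually_at_left_real[of 0 1]
    proof (rule eventually_mono)
      fix r :: real assume "r \<in> {0<..<1}"
      then show "(LINT w|area. f w * cnj (?G' (of_real (r\<^sup>2) * w))) =
        (LINT z:ball 0 r|area. deriv (bergman_projection f) z * cnj (deriv g z))"
        using g by (intro bergman_pairing_on_disc[OF fa, symmetric]) (auto simp: bloch_def)
    qed simp
  qed
qed

section \<open>Uniqueness and linearity\<close>

text \<open>
  The difference \<open>d\<close> of two adjoint values is bounded, so \<open>(1 - |z|\<^sup>2)\<^sup>2 d(z)\<close> is integrable for the
  invariant measure. Used as test function it turns equality of the pairings into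
  \<open>\<integral> |d|\<^sup>2 dA = 0\<close>.
\<close>

lemma adjoint_value_unique:
  assumes u: "is_adjoint_value g u" and v: "is_adjoint_value g v"
  shows "AE z in area. u z = v z"
proof -
  have [measurable]: "u \<in> borel_measurable area" "v \<in> borel_measurable area"
    using u v by (auto simp: is_adjoint_value_def Linf_def)
  obtain A B where A: "AE z in area. cmod (u z) \<le> A" and B: "AE z in area. cmod (v z) \<le> B"
    using u v Linf_AE_bounded unfolding is_adjoint_value_def by metis
  define d where "d z = u z - v z" for z
  have [measurable]: "d \<in> borel_measurable area" unfolding d_def by measurable
  define f where "f z = of_real ((1 - (cmod z)\<^sup>2)\<^sup>2) * d z" for z
  have [measurable]: "f \<in> borel_measurable area" unfolding f_def by measurable
  have quot: "f z / of_real ((1 - (cmod z)\<^sup>2)\<^sup>2) = d z" if "cmod z < 1" for z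
    using weight_pos[OF that] by (simp add: f_def del: of_real_power of_real_diff)
  have int_d: "integrable area (\<lambda>z. d z * cnj (w z))"
    if "AE z in area. cmod (w z) \<le> C" "w \<in> borel_measurable area" for w C
  proof (rule area.integrable_const_bound[where B="(A + B) * C"])
    show "AE z in area. norm (d z * cnj (w z)) \<le> (A + B) * C"
      using A B that(1)
    proof eventually_elim
      case (elim z)
      have "cmod (d z) \<le> A + B"
        unfolding d_def using elim by (intro order.trans[OF norm_triangle_ineq4]) auto
      then show ?case
        using elim by (auto simp: norm_mult intro!: mult_mono order.trans[OF norm_ge_zero])
    qed
    show "(\<lambda>z. d z * cnj (w z)) \<in> borel_measurable area"
      using that(2) by measurable
  qed
  have "integrable area (\<lambda>z. f z / of_real ((1 - (cmod z)\<^sup>2)\<^sup>2))"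
  proof -
    have "integrable area d"
      using int_d[of "\<lambda>_. 1" 1] by simp
    then show ?thesis
      using quot by (subst Bochner_Integration.integrable_cong[OF refl, of _ _ d]) auto
  qed
  then have f: "f \<in> L1_moebius"
    by (simp add: L1_moebius_def integrable_moebius_iff)
  have val: "(LINT z|moebius_measure. f z * cnj (w z)) = (LINT z|area. d z * cnj (w z))"
    if [measurable]: "w \<in> borel_measurable area" for w
  proof -
    have "(LINT z|moebius_measure. f z * cnj (w z)) =
        (LINT z|area. f z / of_real ((1 - (cmod z)\<^sup>2)\<^sup>2) * cnj (w z))"
      by (subst integral_moebius) simp_all
    also have "\<dots> = (LINT z|area. d z * cnj (w z))"
      using quot by (intro Bochner_Integration.integral_cong) auto
    finally show ?thesis .
  qed
  have "(LINT z|moebius_measure. f z * cnj (u z)) = (LINT z|moebius_measure. f z * cnj (v z))"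
  proof (rule tendsto_unique[OF trivial_limit_at_left_real[of 1]])
    let ?I = "\<lambda>r::real. LINT z:ball 0 r|area. deriv (bergman_projection f) z * cnj (deriv g z)"
    show "(?I \<longlongrightarrow> (LINT z|moebius_measure. f z * cnj (u z))) (at_left 1)"
      "(?I \<longlongrightarrow> (LINT z|moebius_measure. f z * cnj (v z))) (at_left 1)"
      using u v f by (auto simp: is_adjoint_value_def has_invariant_pairing_def)
  qed
  then have "(LINT z|area. d z * cnj (u z)) - (LINT z|area. d z * cnj (v z)) = 0"
    by (simp add: val)
  then have "(LINT z|area. d z * cnj (u z) - d z * cnj (v z)) = 0"
    using int_d[OF A] int_d[OF B] by (subst Bochner_Integration.integral_diff) auto
  moreover have "d z * cnj (u z) - d z * cnj (v z) = of_real ((cmod (d z))\<^sup>2)" for z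
    unfolding complex_norm_square by (simp add: d_def algebra_simps)
  ultimately have "(LINT z|area. complex_of_real ((cmod (d z))\<^sup>2)) = 0"
    by simp
  then have "(LINT z|area. (cmod (d z))\<^sup>2) = 0"
    by (simp only: integral_complex_of_real of_real_eq_0_iff)
  moreover have "integrable area (\<lambda>z. (cmod (d z))\<^sup>2)"
  proof (rule area.integrable_const_bound[where B="(A + B)\<^sup>2"])
    show "AE z in area. norm ((cmod (d z))\<^sup>2) \<le> (A + B)\<^sup>2"
      using A B
    proof eventually_elim
      case (elim z)
      have "cmod (d z) \<le> A + B"
        unfolding d_def using elim by (intro order.trans[OF norm_triangle_ineq4]) auto
      then show ?case by (simp add: power_mono)
    qed
  qed measurable
  ultimately have "AE z in area. (cmod (d z))\<^sup>2 = 0"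
    by (subst (asm) integral_nonneg_eq_0_iff_AE) auto
  then show ?thesis
    by eventually_elim (simp add: d_def)
qed

lemma deriv_linear_combination:
  assumes g: "g holomorphic_on unit_disc" and h: "h holomorphic_on unit_disc" and z: "cmod z < 1"
  shows "deriv (\<lambda>w. a * g w + b * h w) z = a * deriv g z + b * deriv h z"
  using holomorphic_derivI[OF g open_ball, of z] holomorphic_derivI[OF h open_ball, of z] z
  by (intro DERIV_imp_deriv) (auto intro!: derivative_eq_intros)

lemma bloch_linear_combination:
  assumes g: "g \<in> bloch" and h: "h \<in> bloch"
  shows "(\<lambda>w. a * g w + b * h w) \<in> bloch"
proof -
  have hol: "g holomorphic_on unit_disc" "h holomorphic_on unit_disc"
    using g h by (auto simp: bloch_def)
  note D = deriv_linear_combination[OF hol]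
  have "(1 - (cmod z)\<^sup>2) * cmod (deriv (\<lambda>w. a * g w + b * h w) z) \<le>
      cmod a * bloch_seminorm g + cmod b * bloch_seminorm h" if z: "cmod z < 1" for z
  proof -
    have "0 \<le> 1 - (cmod z)\<^sup>2" using z by (simp add: abs_square_le_1 less_imp_le)
    then have "(1 - (cmod z)\<^sup>2) * cmod (a * deriv g z + b * deriv h z) \<le>
        (1 - (cmod z)\<^sup>2) * (cmod a * cmod (deriv g z) + cmod b * cmod (deriv h z))"
      by (intro mult_left_mono order.trans[OF norm_triangle_ineq]) (auto simp: norm_mult)
    also have "\<dots> = cmod a * ((1 - (cmod z)\<^sup>2) * cmod (deriv g z)) +
        cmod b * ((1 - (cmod z)\<^sup>2) * cmod (deriv h z))"
      by (simp add: algebra_simps)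
    also have "\<dots> \<le> cmod a * bloch_seminorm g + cmod b * bloch_seminorm h"
      using g h z by (intro add_mono mult_left_mono bloch_seminorm_upper) auto
    finally show ?thesis by (simp add: D[OF z])
  qed
  moreover have "(\<lambda>w. a * g w + b * h w) holomorphic_on unit_disc"
    using hol by (intro holomorphic_intros)
  ultimately show ?thesis
    unfolding bloch_def by (auto intro!: bdd_aboveI2)
qed

lemma adjoint_symbol_linear:
  assumes g: "g holomorphic_on unit_disc" and h: "h holomorphic_on unit_disc" and z: "cmod z < 1"
  shows "adjoint_symbol (\<lambda>w. a * g w + b * h w) z = a * adjoint_symbol g z + b * adjoint_symbol h z"
proof -
  note D = deriv_linear_combination[OF g h]
  let ?D = "\<lambda>g. deriv (\<lambda>z. z\<^sup>2 * deriv g z)"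
  have "((\<lambda>z. a * (z\<^sup>2 * deriv g z) + b * (z\<^sup>2 * deriv h z)) has_field_derivative
      a * ?D g z + b * ?D h z) (at z)"
    using holomorphic_derivI[OF holomorphic_square_times_deriv[OF g] open_ball, of z]
      holomorphic_derivI[OF holomorphic_square_times_deriv[OF h] open_ball, of z] z
    by (intro DERIV_add DERIV_cmult) auto
  then have "((\<lambda>z. z\<^sup>2 * deriv (\<lambda>w. a * g w + b * h w) z) has_field_derivative
      a * ?D g z + b * ?D h z) (at z)"
    by (rule has_field_derivative_transform_within_open[OF _ open_ball[of 0 1]])
      (use z D in \<open>auto simp: algebra_simps\<close>)
  then show ?thesis
    by (simp add: adjoint_symbol_def DERIV_imp_deriv algebra_simps)
qed

lemma bergman_adjoint_is_adjoint_value: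
  assumes "g \<in> bloch"
  shows "is_adjoint_value g (bergman_adjoint g)"
  unfolding bergman_adjoint_def using is_adjoint_value_adjoint_symbol[OF assms] by (rule someI[of "is_adjoint_value g"])

lemma bergman_adjoint_AE:
  assumes "g \<in> bloch"
  shows "AE z in area. bergman_adjoint g z = adjoint_symbol g z"
  using adjoint_value_unique bergman_adjoint_is_adjoint_value is_adjoint_value_adjoint_symbol assms
  by blast

lemma Linf_norm_bergman_adjoint:
  assumes "g \<in> bloch"
  shows "Linf_norm (bergman_adjoint g) = Linf_norm (adjoint_symbol g)"
  using bergman_adjoint_is_adjoint_value[OF assms] assms
  by (intro Linf_norm_cong_AE bergman_adjoint_AE) (auto simp: is_adjoint_value_def Linf_def)

section \<open>A Bloch function that gives the lower bound\<close>

text \<open>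
  The points where \<open>|u|\<close> exceeds \<open>C\<close> form an open set, and nonempty open subsets of the disc have
  positive area.
\<close>

lemma continuous_AE_bounded:
  fixes u :: "complex \<Rightarrow> complex"
  assumes u: "continuous_on unit_disc u" and AE: "AE z in area. cmod (u z) \<le> C" and z: "cmod z < 1"
  shows "cmod (u z) \<le> C"
proof (rule ccontr)
  assume "\<not> cmod (u z) \<le> C"
  define U where "U = unit_disc \<inter> (\<lambda>z. cmod (u z)) -` {C<..}"
  have "open U"
    unfolding U_def by (intro continuous_open_preimage continuous_intros u) auto
  have U: "U \<in> sets borel" "U \<subseteq> unit_disc"
    using \<open>open U\<close> by (auto simp: U_def)
  have "z \<in> U"
    using z \<open>\<not> cmod (u z) \<le> C\<close> by (simp add: U_def)
  have "{x \<in> space area. \<not> cmod (u x) \<le> C} = U"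
    by (auto simp: U_def)
  moreover have "U \<in> sets area"
    using U by (auto simp: sets_area sets_restrict_space_iff)
  ultimately have "emeasure area U = 0"
    using AE by (simp add: AE_iff_null null_sets_def)
  then have "emeasure lborel U = 0"
    using emeasure_area[OF U] pi_gt_zero by (auto simp: ennreal_eq_0_iff)
  moreover obtain e where e: "0 < e" "ball z e \<subseteq> U"
    using \<open>open U\<close> \<open>z \<in> U\<close> by (meson openE)
  moreover have "emeasure lborel (ball z e) \<le> emeasure lborel U"
    using e U by (intro emeasure_mono) auto
  ultimately have "emeasure lborel (ball z e) = 0" by simp
  then show False
    using e by (simp add: emeasure_ball unit_ball_vol_2)
qed

text \<open>
  The inverse hyperbolic tangent, which on the real diameter is the signed hyperbolic distance from
  \<open>0\<close>. Writing \<open>g\<close> for it, \<open>(1 - |z|\<^sup>2) |g'(z)|\<close> attains its supremum \<open>1\<close> at every point of that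
  diameter.
\<close>

definition bloch_log :: "complex \<Rightarrow> complex" where
  "bloch_log z = (Ln (1 + z) - Ln (1 - z)) / 2"

lemma has_field_derivative_bloch_log:
  assumes z: "cmod z < 1"
  shows "(bloch_log has_field_derivative 1 / (1 - z\<^sup>2)) (at z)"
proof -
  have re: "\<bar>Re z\<bar> < 1" using abs_Re_le_cmod[of z] z by linarith
  then have nz: "1 + z \<notin> \<real>\<^sub>\<le>\<^sub>0" "1 - z \<notin> \<real>\<^sub>\<le>\<^sub>0"
    by (auto simp: complex_nonpos_Reals_iff)
  then have "1 + z \<noteq> 0" "1 - z \<noteq> 0" by auto
  moreover have "1 - z\<^sup>2 = (1 + z) * (1 - z)"
    by (simp add: algebra_simps power2_eq_square)
  ultimately have "(1 / (1 + z) + 1 / (1 - z)) / 2 = 1 / (1 - z\<^sup>2)"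
    by (simp add: add_frac_eq)
  moreover have "(bloch_log has_field_derivative (1 / (1 + z) + 1 / (1 - z)) / 2) (at z)"
    unfolding bloch_log_def using nz by (auto intro!: derivative_eq_intros simp: field_simps)
  ultimately show ?thesis by (simp only:)
qed

lemma deriv_bloch_log: "cmod z < 1 \<Longrightarrow> deriv bloch_log z = 1 / (1 - z\<^sup>2)"
  by (rule DERIV_imp_deriv[OF has_field_derivative_bloch_log])

lemma bloch_log_deriv_bound:
  assumes z: "cmod z < 1"
  shows "(1 - (cmod z)\<^sup>2) * cmod (deriv bloch_log z) \<le> 1"
proof -
  have "1 - (cmod z)\<^sup>2 \<le> cmod (1 - z\<^sup>2)"
    using norm_triangle_ineq2[of 1 "z\<^sup>2"] by (simp add: norm_power)
  moreover have "(cmod z)\<^sup>2 < 1"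
    using z by (simp add: abs_square_less_1)
  ultimately have "(1 - (cmod z)\<^sup>2) / cmod (1 - z\<^sup>2) \<le> 1"
    by (subst pos_divide_le_eq) auto
  then show ?thesis
    by (simp add: deriv_bloch_log[OF z] norm_divide)
qed

lemma bloch_log_in_bloch: "bloch_log \<in> bloch"
proof -
  have "bloch_log holomorphic_on unit_disc"
    by (rule holomorphic_onI) (use has_field_derivative_bloch_log in
      \<open>auto simp: field_differentiable_def intro: has_field_derivative_at_within\<close>)
  then show ?thesis
    unfolding bloch_def using bloch_log_deriv_bound by (auto intro!: bdd_aboveI2)
qed

lemma bloch_seminorm_bloch_log: "bloch_seminorm bloch_log \<le> 1"
  unfolding bloch_seminorm_def using bloch_log_deriv_bound by (intro cSUP_least) auto

text \<open>
  Here \<open>z\<^sup>2 g'(z) = z\<^sup>2 / (1 - z\<^sup>2)\<close> has derivative \<open>2z / (1 - z\<^sup>2)\<^sup>2\<close>, and on the real diameter the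
  weight cancels the denominator.
\<close>

lemma adjoint_symbol_bloch_log:
  assumes x: "0 \<le> x" "x < 1"
  shows "adjoint_symbol bloch_log (of_real x) = of_real (2 * x)"
proof -
  have x2: "x\<^sup>2 < 1" using x by (simp add: abs_square_less_1)
  then have nz: "1 - (complex_of_real x)\<^sup>2 \<noteq> 0"
    by (metis eq_iff_diff_eq_0 of_real_eq_1_iff of_real_power order_less_irrefl)
  have "((\<lambda>z. z\<^sup>2 * (1 / (1 - z\<^sup>2))) has_field_derivative
      2 * of_real x / (1 - (of_real x)\<^sup>2)\<^sup>2) (at (of_real x :: complex))"
    using nz by (auto intro!: derivative_eq_intros simp: field_simps power2_eq_square)
  then have "((\<lambda>z. z\<^sup>2 * deriv bloch_log z) has_field_derivative
      2 * of_real x / (1 - (of_real x)\<^sup>2)\<^sup>2) (at (of_real x))"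
    by (rule has_field_derivative_transform_within_open[OF _ open_ball[of 0 1]])
      (use x in \<open>auto simp: deriv_bloch_log\<close>)
  then have "deriv (\<lambda>z. z\<^sup>2 * deriv bloch_log z) (of_real x) = 2 * of_real x / (1 - (of_real x)\<^sup>2)\<^sup>2"
    by (rule DERIV_imp_deriv)
  then show ?thesis
    using nz x by (simp add: adjoint_symbol_def)
qed

lemma two_le_admissible_constant:
  assumes "Linf_norm (bergman_adjoint bloch_log) \<le> ereal (C * bloch_seminorm bloch_log)" and C: "0 \<le> C"
  shows "2 \<le> C"
proof -
  have "C * bloch_seminorm bloch_log \<le> C * 1"
    using C bloch_seminorm_bloch_log by (intro mult_left_mono)
  then have le: "Linf_norm (adjoint_symbol bloch_log) \<le> ereal C"
    using assms(1) Linf_norm_bergman_adjoint[OF bloch_log_in_bloch]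
    by (metis ereal_less_eq(3) mult.right_neutral order.trans)
  have "AE z in area. ereal (cmod (adjoint_symbol bloch_log z)) \<le> Linf_norm (adjoint_symbol bloch_log)"
    unfolding Linf_norm_def by (rule esssup_AE)
  then have AE: "AE z in area. cmod (adjoint_symbol bloch_log z) \<le> C"
    by eventually_elim (use le order.trans in fastforce)
  have cont: "continuous_on unit_disc (adjoint_symbol bloch_log)"
    using bloch_log_in_bloch by (intro continuous_on_adjoint_symbol) (simp add: bloch_def)
  have "2 * x \<le> C" if "0 < x" "x < 1" for x
    using continuous_AE_bounded[OF cont AE, of "of_real x"] adjoint_symbol_bloch_log[of x] that
    by (simp del: of_real_mult)
  then have "x \<le> C / 2" if "0 < x" "x < 1" for x
    using that by fastforce
  then have "1 \<le> C / 2"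
    by (rule dense_le_bounded[rotated]) auto
  then show ?thesis by simp
qed

lemma Linf_norm_bergman_adjoint_le:
  assumes "g \<in> bloch"
  shows "Linf_norm (bergman_adjoint g) \<le> ereal (4 * bloch_seminorm g)"
  using adjoint_symbol_in_Linf(2)[OF assms] by (simp add: Linf_norm_bergman_adjoint[OF assms])

lemma bergman_adjoint_linear_AE:
  assumes g: "g \<in> bloch" and h: "h \<in> bloch"
  shows "AE z in area. bergman_adjoint (\<lambda>w. a * g w + b * h w) z =
    a * bergman_adjoint g z + b * bergman_adjoint h z"
  using bergman_adjoint_AE[OF bloch_linear_combination[OF g h, of a b]] bergman_adjoint_AE[OF g]
    bergman_adjoint_AE[OF h] AE_space
proof eventually_elim
  case (elim z)
  then show ?case
    using adjoint_symbol_linear[of g h z a b] g h by (simp add: bloch_def)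
qed

theorem theorem7:
  shows
    "(\<forall>g\<in>bloch. is_adjoint_value g (bergman_adjoint g) \<and>
        (\<forall>u. is_adjoint_value g u \<longrightarrow> (AE z in area. u z = bergman_adjoint g z))) \<and>
     (\<forall>g\<in>bloch. \<forall>h\<in>bloch. \<forall>a b :: complex.
        AE z in area. bergman_adjoint (\<lambda>w. a * g w + b * h w) z =
          a * bergman_adjoint g z + b * bergman_adjoint h z) \<and>
     (\<exists>C::real. \<forall>g\<in>bloch. Linf_norm (bergman_adjoint g) \<le> ereal (C * bloch_seminorm g)) \<and>
     2 \<le> bloch_Linf_opnorm bergman_adjoint \<and> bloch_Linf_opnorm bergman_adjoint \<le> 4"
proof (intro conjI ballI allI impI)
  show "is_adjoint_value g (bergman_adjoint g)" if "g \<in> bloch" for g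
    by (rule bergman_adjoint_is_adjoint_value[OF that])
  show "AE z in area. u z = bergman_adjoint g z" if "g \<in> bloch" "is_adjoint_value g u" for g u
    using that bergman_adjoint_is_adjoint_value by (blast intro: adjoint_value_unique)
  show "AE z in area. bergman_adjoint (\<lambda>w. a * g w + b * h w) z =
      a * bergman_adjoint g z + b * bergman_adjoint h z" if "g \<in> bloch" "h \<in> bloch" for g h a b
    by (rule bergman_adjoint_linear_AE[OF that])
  show "\<exists>C::real. \<forall>g\<in>bloch. Linf_norm (bergman_adjoint g) \<le> ereal (C * bloch_seminorm g)"
    using Linf_norm_bergman_adjoint_le by blast
  show "bloch_Linf_opnorm bergman_adjoint \<le> 4"
    unfolding bloch_Linf_opnorm_def
  proof (rule Inf_lower)
    have "(4::ereal) = ereal 4" by simp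
    then show "4 \<in> ereal ` {C. 0 \<le> C \<and>
        (\<forall>g\<in>bloch. Linf_norm (bergman_adjoint g) \<le> ereal (C * bloch_seminorm g))}"
      using Linf_norm_bergman_adjoint_le by (intro image_eqI[of _ _ 4]) auto
  qed
  show "2 \<le> bloch_Linf_opnorm bergman_adjoint"
    unfolding bloch_Linf_opnorm_def
  proof (rule Inf_greatest)
    fix e assume "e \<in> ereal ` {C. 0 \<le> C \<and>
        (\<forall>g\<in>bloch. Linf_norm (bergman_adjoint g) \<le> ereal (C * bloch_seminorm g))}"
    then obtain C where "e = ereal C" "0 \<le> C"
        "Linf_norm (bergman_adjoint bloch_log) \<le> ereal (C * bloch_seminorm bloch_log)"
      using bloch_log_in_bloch by auto
    then show "2 \<le> e"
      using two_le_admissible_constant[of C] by simp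
  qed
qed

end
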